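(* For Monotone bandits with $M\ge1$ simultaneous plays of varying (blocking) duration, the BalancedIndex policy defined in the context is a $2$-approximation: its time-average expected reward is at least half the value of an optimal policy.
   Context: Setting: $n$ arms; arm $i$ has a finite state set $\mathcal S_i$. There are $M\ge1$ players; each free player may start a play of one arm per time step (an arm is played by at most one player at a time). A play of arm $i$ in state $k\in\mathcal S_i$ lasts $L^i_k\ge1$ steps (known in advance), during which that player cannot play another arm; it yields a single reward $r^i_k\ge0$ at its start. If the previous play of arm $i$ ended $t\ge1$ steps before the current play begins, then at the end of the current play the arm moves to state $j\ne k$ with probability $q^i(k,j)f^i_k(t)$ and otherwise stays in $k$. Arms not being played keep their state and give no reward. Assumptions: $q^i(k,j)\ge0$, $\sum_{j\ne k}q^i(k,j)\le1$; $f^i_k:\{1,2,\dots\}\to[0,1]$ is non-decreasing; $f^i_k$ is piecewise linear with polynomial-size breakpoint set $\mathcal W^i_k\ni1$ (linear between consecutive breakpoints, constant after the last); for each $i$ the directed graph on $\mathcal S_i$ with edges $(j,k)$ for $q^i(j,k)>0$ is strongly connected; the policy may choose starting states. The value is the infinite-horizon time-average expected reward. LP (Balance), with $\Delta P^i_k=\sum_{j\ne k}q^i(k,j)(p^i_j-p^i_k)$ and free $p^i_k$: minimize $M\lambda+\sum_ih_i$ subject to $L^i_k(\lambda+h_i)+(t-1)h_i\ge r^i_k+f^i_k(t)\Delta P^i_k$ for all $i$, $k\in\mathcal S_i$, $t\in\mathcal W^i_k$; $M\lambda=\sum_ih_i$; $\lambda,h_i\ge0$. BalancedIndex policy: take an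 optimal solution. $U_1$ is the set of arms $i$ with $h_i>0$ for which repeatedly playing arm $i$ yields average per-step reward at least $\lambda+h_i$; $U_2$ is the set of arms with $h_i>0$ not in $U_1$. For $i\in U_2$, $k\in\mathcal S_i$, let $t^i_k$ be the smallest $t\in\mathcal W^i_k$ making the constraint $L^i_k(\lambda+h_i)+(t-1)h_i\ge r^i_k+f^i_k(t)\Delta P^i_k$ tight; let $\mathcal G_i=\{k:\Delta P^i_k<0\}$, $\mathcal I_i=\mathcal S_i\setminus\mathcal G_i$; an arm in state $k\in\mathcal I_i$ is "ready" once at least $t^i_k$ steps have elapsed since its last play ended. The policy continuously plays $\min(M,|U_1|)$ arms of $U_1$. If $|U_1|<M$, the remaining players serve $U_2$: whenever a player becomes free it (a) plays an available arm $i\in U_2$ in a state of $\mathcal G_i$ (an arm of $U_2$ observed in a state of $\mathcal G_i$ is played continuously by its player until its state moves into $\mathcal I_i$); (b) otherwise plays any ready arm $i\in U_2$ in a state of $\mathcal I_i$; (c) otherwise idles. *)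

theory Defs
  imports "HOL-Probability.Probability"
begin

section \<open>Instances\<close>

text \<open>
  The arms are the elements of a finite type. For arm \<open>i\<close> and states \<open>k\<close>, \<open>j\<close>:
  \<open>dur B i k\<close> is the duration of a play started in \<open>k\<close>, \<open>rew B i k\<close> its reward,
  \<open>trans B i k j\<close> is the number called \<open>q\<close> in the usual notation, \<open>rate B i k t\<close> is the
  factor \<open>f(t)\<close>, and \<open>brk B i k\<close> is the set of breakpoints of that factor.
\<close>

record ('i, 's) bandits =
  states :: "'i \<Rightarrow> 's set"
  dur :: "'i \<Rightarrow> 's \<Rightarrow> nat"
  rew :: "'i \<Rightarrow> 's \<Rightarrow> real"
  trans :: "'i \<Rightarrow> 's \<Rightarrow> 's \<Rightarrow> real"
  rate :: "'i \<Rightarrow> 's \<Rightarrow> nat \<Rightarrow> real"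
  brk :: "'i \<Rightarrow> 's \<Rightarrow> nat set"

text \<open>
  Functions of the elapsed time are only meaningful for arguments \<open>\<ge> 1\<close>; the value at \<open>0\<close>
  is never used.
\<close>

definition piecewise_linear_on_breaks :: "nat set \<Rightarrow> (nat \<Rightarrow> real) \<Rightarrow> bool" where
  "piecewise_linear_on_breaks W f \<longleftrightarrow>
     finite W \<and> 1 \<in> W \<and> 0 \<notin> W \<and>
     (\<forall>a\<in>W. \<forall>b\<in>W. a < b \<and> {a<..<b} \<inter> W = {} \<longrightarrow>
        (\<forall>t\<in>{a..b}. f t = f a + (f b - f a) * (real t - real a) / (real b - real a))) \<and>
     (\<forall>t\<ge>Max W. f t = f (Max W))"

definition monotone_bandits :: "('i, 's) bandits \<Rightarrow> bool" where
  "monotone_bandits B \<longleftrightarrow> (\<forall>i.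
     finite (states B i) \<and> states B i \<noteq> {} \<and>
     (\<forall>k\<in>states B i.
        1 \<le> dur B i k \<and> 0 \<le> rew B i k \<and>
        (\<forall>j\<in>states B i - {k}. 0 \<le> trans B i k j) \<and>
        (\<Sum>j\<in>states B i - {k}. trans B i k j) \<le> 1 \<and>
        (\<forall>t\<ge>1. 0 \<le> rate B i k t \<and> rate B i k t \<le> 1) \<and>
        mono_on {1..} (rate B i k) \<and>
        piecewise_linear_on_breaks (brk B i k) (rate B i k)) \<and>
     (\<forall>j\<in>states B i. \<forall>k\<in>states B i.
        (j, k) \<in> {(a, b). a \<in> states B i \<and> b \<in> states B i \<and> trans B i a b > 0}\<^sup>*))"


section \<open>Dynamics\<close>

text \<open>
  \<open>Idle k t\<close>: the arm is in state \<open>k\<close> and not being played; a play started at the present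
  step would begin \<open>t \<ge> 1\<close> steps after the end of the previous one (so \<open>t = 1\<close> for
  back-to-back plays).
  \<open>Busy k t m\<close>: the arm is in the course of a play that was started in state \<open>k\<close> at elapsed
  time \<open>t\<close>, and this play still occupies \<open>m \<ge> 1\<close> steps, the present one included.
\<close>

datatype 's status =
    is_idle: Idle (st: 's) (age: nat)
  | Busy (st: 's) (age: nat) (left: nat)

type_synonym ('i, 's) config = "'i \<Rightarrow> 's status"

text \<open>
  A policy is randomized and history-dependent: it sees the past configurations and actions
  (latest first) and the present configuration, and draws the set of arms on which plays are
  started. Players are interchangeable, and each arm has at most one player, so the number of
  occupied players is the number of busy arms.
\<close>

type_synonym ('i, 's) policy =
  "(('i, 's) config \<times> 'i set) list \<Rightarrow> ('i, 's) config \<Rightarrow> 'i set pmf"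

definition next_state :: "('i, 's) bandits \<Rightarrow> 'i \<Rightarrow> 's \<Rightarrow> nat \<Rightarrow> 's pmf" where
  "next_state B i k t = embed_pmf (\<lambda>j.
     if j = k then 1 - (\<Sum>l\<in>states B i - {k}. trans B i k l * rate B i k t)
     else if j \<in> states B i then trans B i k j * rate B i k t
     else 0)"

text \<open>The embedded function is indeed a probability mass function:\<close>

lemma pmf_next_state:
  assumes "monotone_bandits B" "k \<in> states B i" "t \<ge> 1"
  shows "pmf (next_state B i k t) j =
    (if j = k then 1 - (\<Sum>l\<in>states B i - {k}. trans B i k l * rate B i k t)
     else if j \<in> states B i then trans B i k j * rate B i k t
     else 0)"
proof -
  define g where "g = (\<lambda>j.
    if j = k then 1 - (\<Sum>l\<in>states B i - {k}. trans B i k l * rate B i k t)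
     else if j \<in> states B i then trans B i k j * rate B i k t
     else 0)"
  have fin: "finite (states B i)"
    and q0: "\<And>j. j \<in> states B i - {k} \<Longrightarrow> 0 \<le> trans B i k j"
    and q1: "(\<Sum>j\<in>states B i - {k}. trans B i k j) \<le> 1"
    and f01: "0 \<le> rate B i k t" "rate B i k t \<le> 1"
    using assms unfolding monotone_bandits_def by blast+
  have "(\<Sum>l\<in>states B i - {k}. trans B i k l * rate B i k t)
      \<le> (\<Sum>l\<in>states B i - {k}. trans B i k l)"
    using q0 f01 by (intro sum_mono mult_right_le_one_le) auto
  then have g0: "0 \<le> g j" for j
    using q0 q1 f01 by (auto simp: g_def)
  have "(\<Sum>j\<in>states B i. g j) = g k + (\<Sum>j\<in>states B i - {k}. g j)"
    using fin assms(2) by (rule sum.remove)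
  also have "(\<Sum>j\<in>states B i - {k}. g j)
      = (\<Sum>l\<in>states B i - {k}. trans B i k l * rate B i k t)"
    by (intro sum.cong) (auto simp: g_def)
  finally have one: "(\<Sum>j\<in>states B i. g j) = 1"
    by (simp add: g_def)
  have "(\<integral>\<^sup>+ j. ennreal (g j) \<partial>count_space UNIV) = (\<Sum>j\<in>states B i. ennreal (g j))"
    using fin assms(2) by (intro nn_integral_count_space') (auto simp: g_def)
  also have "\<dots> = 1"
    using g0 one by (simp add: sum_ennreal)
  finally have "pmf (embed_pmf g) j = g j"
    using g0 by (intro pmf_embed_pmf) auto
  then show ?thesis
    by (simp add: next_state_def g_def)
qed

text \<open>The status after the present step, if the play still needs \<open>m\<close> further steps:\<close>

definition progress :: "('i, 's) bandits \<Rightarrow> 'i \<Rightarrow> 's \<Rightarrow> nat \<Rightarrow> nat \<Rightarrow> 's status pmf" where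
  "progress B i k t m =
     (if m = 0 then map_pmf (\<lambda>j. Idle j 1) (next_state B i k t)
      else return_pmf (Busy k t m))"

definition arm_step :: "('i, 's) bandits \<Rightarrow> 'i \<Rightarrow> bool \<Rightarrow> 's status \<Rightarrow> 's status pmf" where
  "arm_step B i started s =
     (case s of
        Idle k t \<Rightarrow>
          if started then progress B i k t (dur B i k - 1) else return_pmf (Idle k (t + 1))
      | Busy k t m \<Rightarrow> progress B i k t (m - 1))"

definition config_step ::
    "('i::finite, 's) bandits \<Rightarrow> ('i, 's) config \<Rightarrow> 'i set \<Rightarrow> ('i, 's) config pmf" where
  "config_step B c A = Pi_pmf UNIV undefined (\<lambda>i. arm_step B i (i \<in> A) (c i))"

primrec run :: "('i::finite, 's) bandits \<Rightarrow> ('i, 's) policy \<Rightarrow> ('i, 's) config \<Rightarrow> nat \<Rightarrow>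
    ((('i, 's) config \<times> 'i set) list \<times> ('i, 's) config) pmf" where
  "run B \<pi> c0 0 = return_pmf ([], c0)"
| "run B \<pi> c0 (Suc n) =
     bind_pmf (run B \<pi> c0 n) (\<lambda>(hs, c).
       bind_pmf (\<pi> hs c) (\<lambda>A.
         map_pmf (\<lambda>c'. ((c, A) # hs, c')) (config_step B c A)))"

definition idle_arms :: "('i, 's) config \<Rightarrow> 'i set" where
  "idle_arms c = {i. is_idle (c i)}"

definition busy_arms :: "('i, 's) config \<Rightarrow> 'i set" where
  "busy_arms c = {i. \<not> is_idle (c i)}"

definition feasible_action :: "nat \<Rightarrow> ('i::finite, 's) config \<Rightarrow> 'i set \<Rightarrow> bool" where
  "feasible_action M c A \<longleftrightarrow> A \<subseteq> idle_arms c \<and> card A + card (busy_arms c) \<le> M"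

text \<open>
  A starting configuration consists of arbitrary starting states together with arbitrary
  elapsed times to be used for the first plays.
\<close>

definition start_config :: "('i, 's) bandits \<Rightarrow> ('i, 's) config \<Rightarrow> bool" where
  "start_config B c \<longleftrightarrow> (\<forall>i. \<exists>k\<in>states B i. \<exists>t\<ge>1. c i = Idle k t)"

definition admissible ::
    "('i::finite, 's) bandits \<Rightarrow> nat \<Rightarrow> ('i, 's) policy \<Rightarrow> ('i, 's) config \<Rightarrow> bool" where
  "admissible B M \<pi> c0 \<longleftrightarrow> start_config B c0 \<and>
     (\<forall>n. \<forall>(hs, c)\<in>set_pmf (run B \<pi> c0 n). \<forall>A\<in>set_pmf (\<pi> hs c). feasible_action M c A)"

definition reward :: "('i, 's) bandits \<Rightarrow> ('i, 's) config \<Rightarrow> 'i set \<Rightarrow> real" where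
  "reward B c A = (\<Sum>i\<in>A. rew B i (st (c i)))"

definition expected_reward ::
    "('i::finite, 's) bandits \<Rightarrow> ('i, 's) policy \<Rightarrow> ('i, 's) config \<Rightarrow> nat \<Rightarrow> real" where
  "expected_reward B \<pi> c0 n =
     measure_pmf.expectation
       (bind_pmf (run B \<pi> c0 n) (\<lambda>(hs, c). map_pmf (reward B c) (\<pi> hs c))) (\<lambda>x. x)"

definition average_reward ::
    "('i::finite, 's) bandits \<Rightarrow> ('i, 's) policy \<Rightarrow> ('i, 's) config \<Rightarrow> nat \<Rightarrow> real" where
  "average_reward B \<pi> c0 T = (\<Sum>n<T. expected_reward B \<pi> c0 n) / real T"

text \<open>
  For an arbitrary policy the limit of the averages need not exist. The optimum is taken with
  respect to the limit superior, and specific policies are credited with the limit inferior only.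
\<close>

definition upper_value ::
    "('i::finite, 's) bandits \<Rightarrow> ('i, 's) policy \<Rightarrow> ('i, 's) config \<Rightarrow> ereal" where
  "upper_value B \<pi> c0 = limsup (\<lambda>T. ereal (average_reward B \<pi> c0 T))"

definition lower_value ::
    "('i::finite, 's) bandits \<Rightarrow> ('i, 's) policy \<Rightarrow> ('i, 's) config \<Rightarrow> ereal" where
  "lower_value B \<pi> c0 = liminf (\<lambda>T. ereal (average_reward B \<pi> c0 T))"

definition optimal_value :: "('i::finite, 's) bandits \<Rightarrow> nat \<Rightarrow> ereal" where
  "optimal_value B M = (SUP (\<pi>, c0)\<in>{(\<pi>, c0). admissible B M \<pi> c0}. upper_value B \<pi> c0)"


section \<open>The linear program (Balance)\<close>

definition DeltaP :: "('i, 's) bandits \<Rightarrow> ('i \<Rightarrow> 's \<Rightarrow> real) \<Rightarrow> 'i \<Rightarrow> 's \<Rightarrow> real" where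
  "DeltaP B p i k = (\<Sum>j\<in>states B i - {k}. trans B i k j * (p i j - p i k))"

definition balance_lhs ::
    "('i, 's) bandits \<Rightarrow> real \<Rightarrow> ('i \<Rightarrow> real) \<Rightarrow> 'i \<Rightarrow> 's \<Rightarrow> nat \<Rightarrow> real" where
  "balance_lhs B lam h i k t = real (dur B i k) * (lam + h i) + (real t - 1) * h i"

definition balance_rhs ::
    "('i, 's) bandits \<Rightarrow> ('i \<Rightarrow> 's \<Rightarrow> real) \<Rightarrow> 'i \<Rightarrow> 's \<Rightarrow> nat \<Rightarrow> real" where
  "balance_rhs B p i k t = rew B i k + rate B i k t * DeltaP B p i k"

definition balance_feasible :: "('i::finite, 's) bandits \<Rightarrow> nat \<Rightarrow>
    real \<Rightarrow> ('i \<Rightarrow> real) \<Rightarrow> ('i \<Rightarrow> 's \<Rightarrow> real) \<Rightarrow> bool" where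
  "balance_feasible B M lam h p \<longleftrightarrow>
     0 \<le> lam \<and> (\<forall>i. 0 \<le> h i) \<and> real M * lam = (\<Sum>i\<in>UNIV. h i) \<and>
     (\<forall>i. \<forall>k\<in>states B i. \<forall>t\<in>brk B i k. balance_lhs B lam h i k t \<ge> balance_rhs B p i k t)"

definition balance_optimal :: "('i::finite, 's) bandits \<Rightarrow> nat \<Rightarrow>
    real \<Rightarrow> ('i \<Rightarrow> real) \<Rightarrow> ('i \<Rightarrow> 's \<Rightarrow> real) \<Rightarrow> bool" where
  "balance_optimal B M lam h p \<longleftrightarrow>
     balance_feasible B M lam h p \<and>
     (\<forall>lam' h' p'. balance_feasible B M lam' h' p' \<longrightarrow>
        real M * lam + (\<Sum>i\<in>UNIV. h i) \<le> real M * lam' + (\<Sum>i\<in>UNIV. h' i))"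


section \<open>The BalancedIndex policy\<close>

definition repeat_play :: "'i \<Rightarrow> ('i, 's) policy" where
  "repeat_play i = (\<lambda>hs c. return_pmf (if is_idle (c i) then {i} else {}))"

text \<open>
  The average reward of playing arm \<open>i\<close> repeatedly can depend on where the arm starts
  (a state whose factor vanishes at elapsed time \<open>1\<close> is never left by back-to-back plays).
  As starting states can be chosen, one suitable start suffices for membership in \<open>U1\<close>.
  Only the component \<open>c0 i\<close> of the starting configuration matters here.
\<close>

definition U1 :: "('i::finite, 's) bandits \<Rightarrow> real \<Rightarrow> ('i \<Rightarrow> real) \<Rightarrow> 'i set" where
  "U1 B lam h = {i. 0 < h i \<and>
     (\<exists>c0. start_config B c0 \<and> ereal (lam + h i) \<le> lower_value B (repeat_play i) c0)}"

definition U2 :: "('i::finite, 's) bandits \<Rightarrow> real \<Rightarrow> ('i \<Rightarrow> real) \<Rightarrow> 'i set" where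
  "U2 B lam h = {i. 0 < h i} - U1 B lam h"

definition ready_time ::
    "('i, 's) bandits \<Rightarrow> real \<Rightarrow> ('i \<Rightarrow> real) \<Rightarrow> ('i \<Rightarrow> 's \<Rightarrow> real) \<Rightarrow> 'i \<Rightarrow> 's \<Rightarrow> nat" where
  "ready_time B lam h p i k =
     (LEAST t. t \<in> brk B i k \<and> balance_lhs B lam h i k t = balance_rhs B p i k t)"

definition G_states :: "('i, 's) bandits \<Rightarrow> ('i \<Rightarrow> 's \<Rightarrow> real) \<Rightarrow> 'i \<Rightarrow> 's set" where
  "G_states B p i = {k \<in> states B i. DeltaP B p i k < 0}"

definition I_states :: "('i, 's) bandits \<Rightarrow> ('i \<Rightarrow> 's \<Rightarrow> real) \<Rightarrow> 'i \<Rightarrow> 's set" where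
  "I_states B p i = states B i - G_states B p i"

definition G_avail :: "('i::finite, 's) bandits \<Rightarrow> real \<Rightarrow> ('i \<Rightarrow> real) \<Rightarrow> ('i \<Rightarrow> 's \<Rightarrow> real) \<Rightarrow>
    ('i, 's) config \<Rightarrow> 'i set" where
  "G_avail B lam h p c = {i \<in> U2 B lam h. is_idle (c i) \<and> st (c i) \<in> G_states B p i}"

definition I_ready :: "('i::finite, 's) bandits \<Rightarrow> real \<Rightarrow> ('i \<Rightarrow> real) \<Rightarrow> ('i \<Rightarrow> 's \<Rightarrow> real) \<Rightarrow>
    ('i, 's) config \<Rightarrow> 'i set" where
  "I_ready B lam h p c = {i \<in> U2 B lam h. is_idle (c i) \<and> st (c i) \<in> I_states B p i \<and>
     ready_time B lam h p i (st (c i)) \<le> age (c i)}"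

text \<open>
  \<open>V\<close> is the set of arms of \<open>U1\<close> that are played continuously. After step \<open>0\<close>
  (\<open>hs \<noteq> []\<close>), an idle arm has age \<open>1\<close> exactly if a play of it has just ended; if it is then in a
  state of \<open>G_states\<close>, its player has to continue. The last two conjuncts give arms in
  \<open>G_states\<close> priority over ready arms, and let a player idle only if no such arm is left.
  If \<open>V\<close> has \<open>M\<close> elements, feasibility leaves no player for the arms of \<open>U2\<close>.
\<close>

definition balanced_index_action :: "('i::finite, 's) bandits \<Rightarrow> nat \<Rightarrow>
    real \<Rightarrow> ('i \<Rightarrow> real) \<Rightarrow> ('i \<Rightarrow> 's \<Rightarrow> real) \<Rightarrow> 'i set \<Rightarrow>
    (('i, 's) config \<times> 'i set) list \<Rightarrow> ('i, 's) config \<Rightarrow> 'i set \<Rightarrow> bool" where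
  "balanced_index_action B M lam h p V hs c A \<longleftrightarrow>
     feasible_action M c A \<and>
     V \<inter> idle_arms c \<subseteq> A \<and>
     A \<subseteq> V \<union> G_avail B lam h p c \<union> I_ready B lam h p c \<and>
     (\<forall>i\<in>G_avail B lam h p c. hs \<noteq> [] \<and> age (c i) = 1 \<longrightarrow> i \<in> A) \<and>
     (A \<inter> I_ready B lam h p c \<noteq> {} \<longrightarrow> G_avail B lam h p c \<subseteq> A) \<and>
     (card A + card (busy_arms c) < M \<longrightarrow>
        G_avail B lam h p c \<union> I_ready B lam h p c \<subseteq> A)"

text \<open>
  \<open>\<pi>\<close>, started in \<open>c0\<close>, is an execution of BalancedIndex for the solution \<open>(lam, h, p)\<close>.
  All choices the policy leaves open (which arms of \<open>U1\<close>, ties between available arms, starting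
  states of the arms outside \<open>V\<close>) are arbitrary; the arms in \<open>V\<close> start where playing them
  repeatedly has the average reward required for \<open>U1\<close>.
\<close>

definition balanced_index :: "('i::finite, 's) bandits \<Rightarrow> nat \<Rightarrow>
    real \<Rightarrow> ('i \<Rightarrow> real) \<Rightarrow> ('i \<Rightarrow> 's \<Rightarrow> real) \<Rightarrow>
    ('i, 's) policy \<Rightarrow> ('i, 's) config \<Rightarrow> bool" where
  "balanced_index B M lam h p \<pi> c0 \<longleftrightarrow>
     start_config B c0 \<and>
     (\<exists>V. V \<subseteq> U1 B lam h \<and> card V = min M (card (U1 B lam h)) \<and>
        (\<forall>i\<in>V. ereal (lam + h i) \<le> lower_value B (repeat_play i) c0) \<and>
        (\<forall>n. \<forall>(hs, c)\<in>set_pmf (run B \<pi> c0 n). \<forall>A\<in>set_pmf (\<pi> hs c).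
           balanced_index_action B M lam h p V hs c A))"

end

theory Submission
  imports Defs
begin

text \<open>
  Both bounds come from one potential argument. For any feasible solution of the linear program,
  let an arm earn \<open>h i\<close> in every step and each occupied player \<open>lam\<close>; with \<open>p i k\<close> as potential of
  state \<open>k\<close>, the constraints say that a play never yields more than has been saved up for it, so no
  policy exceeds \<open>M * lam + (\<Sum>i. h i) = 2 * M * lam\<close>.

  At an optimal solution every state of an arm of \<open>U2\<close> has a tight constraint: otherwise
  perturbing \<open>p i\<close> makes all constraints of the arm slack and \<open>lam\<close> could be decreased, except if
  some tight constraint has rate \<open>0\<close>, in which case staying in that state puts the arm into \<open>U1\<close>.
  By monotonicity, tightness means that plays of BalancedIndex earn at least what has been saved.
  Hence in each step either all players are occupied, earning \<open>M * lam\<close>, or every arm with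
  \<open>h i > 0\<close> earns \<open>h i\<close>; both totals equal \<open>M * lam\<close> by balance.
\<close>

section \<open>Liminf of averages\<close>

text \<open>Restates the bound with real epsilons, so that liminf bounds can be added without
  extended arithmetic.\<close>

lemma ereal_le_liminf_iff:
  fixes X :: "nat \<Rightarrow> real"
  shows "ereal a \<le> liminf (\<lambda>n. ereal (X n)) \<longleftrightarrow> (\<forall>e>0. \<forall>\<^sub>F n in sequentially. a - e < X n)"
proof
  assume "ereal a \<le> liminf (\<lambda>n. ereal (X n))"
  then have *: "\<And>y. y < ereal a \<Longrightarrow> \<forall>\<^sub>F n in sequentially. y < ereal (X n)"
    by (simp add: le_Liminf_iff)
  show "\<forall>e>0. \<forall>\<^sub>F n in sequentially. a - e < X n"
    using *[of "ereal (a - _)"] by simp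
next
  assume *: "\<forall>e>0. \<forall>\<^sub>F n in sequentially. a - e < X n"
  show "ereal a \<le> liminf (\<lambda>n. ereal (X n))"
    unfolding le_Liminf_iff
  proof (intro allI impI)
    fix y :: ereal assume y: "y < ereal a"
    show "\<forall>\<^sub>F n in sequentially. y < ereal (X n)"
    proof (cases y)
      case (real r)
      with y * have "\<forall>\<^sub>F n in sequentially. a - (a - r) < X n" by (metis diff_gt_0_iff_gt less_ereal.simps(1))
      then show ?thesis using real by simp
    qed (use y in auto)
  qed
qed

lemma ereal_le_liminf_add:
  fixes X Y :: "nat \<Rightarrow> real"
  assumes "ereal a \<le> liminf (\<lambda>n. ereal (X n))" "ereal b \<le> liminf (\<lambda>n. ereal (Y n))"
  shows "ereal (a + b) \<le> liminf (\<lambda>n. ereal (X n + Y n))"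
  unfolding ereal_le_liminf_iff
proof (intro allI impI)
  fix e :: real assume "0 < e"
  then have "0 < e / 2" by simp
  with assms have "\<forall>\<^sub>F n in sequentially. a - e / 2 < X n" "\<forall>\<^sub>F n in sequentially. b - e / 2 < Y n"
    by (auto simp: ereal_le_liminf_iff)
  then show "\<forall>\<^sub>F n in sequentially. a + b - e < X n + Y n"
  proof eventually_elim
    case (elim n)
    then show ?case by argo
  qed
qed

lemma ereal_le_liminf_sum:
  fixes X :: "'a \<Rightarrow> nat \<Rightarrow> real"
  assumes "finite I" "\<And>i. i \<in> I \<Longrightarrow> ereal (a i) \<le> liminf (\<lambda>n. ereal (X i n))"
  shows "ereal (\<Sum>i\<in>I. a i) \<le> liminf (\<lambda>n. ereal (\<Sum>i\<in>I. X i n))"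
  using assms
proof (induction I rule: finite_induct)
  case empty
  then show ?case by (simp add: Liminf_const zero_ereal_def)
next
  case (insert j I)
  then have "ereal (a j + (\<Sum>i\<in>I. a i)) \<le> liminf (\<lambda>n. ereal (X j n + (\<Sum>i\<in>I. X i n)))"
    by (intro ereal_le_liminf_add) auto
  then show ?case using insert.hyps by simp
qed

text \<open>The error \<open>D\<close> is independent of \<open>T\<close> and vanishes after
  division by \<open>T\<close>; bounded potentials and finitely many initial steps end up in
  it.\<close>

lemma ereal_le_liminf_average:
  fixes S :: "nat \<Rightarrow> real"
  assumes "\<And>T. T \<ge> N \<Longrightarrow> real T * K - D \<le> S T"
  shows "ereal K \<le> liminf (\<lambda>T. ereal (S T / real T))"
proof -
  have lim: "(\<lambda>T. K - D / real T) \<longlonglongrightarrow> K - 0"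
    by (intro tendsto_intros lim_const_over_n)
  have "\<forall>\<^sub>F T in sequentially. K - D / real T \<le> S T / real T"
    using eventually_ge_at_top[of N] eventually_gt_at_top[of 0]
  proof eventually_elim
    case (elim T)
    then have "K - D / real T = (real T * K - D) / real T" by (simp add: field_simps)
    also have "\<dots> \<le> S T / real T" using assms[of T] elim by (intro divide_right_mono) auto
    finally show ?case .
  qed
  then have "liminf (\<lambda>T. ereal (K - D / real T)) \<le> liminf (\<lambda>T. ereal (S T / real T))"
    by (intro Liminf_mono) simp
  moreover have "liminf (\<lambda>T. ereal (K - D / real T)) = ereal K"
    using lim by (intro lim_imp_Liminf) auto
  ultimately show ?thesis by simp
qed

text \<open>The previous bound applied to \<open>- S\<close>.\<close>

lemma limsup_average_le_ereal:
  fixes S :: "nat \<Rightarrow> real"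
  assumes "\<And>T. T \<ge> N \<Longrightarrow> S T \<le> real T * K + D"
  shows "limsup (\<lambda>T. ereal (S T / real T)) \<le> ereal K"
proof -
  have "ereal (- K) \<le> liminf (\<lambda>T. ereal (- S T / real T))"
    using assms by (intro ereal_le_liminf_average[of N _ D]) (force simp: algebra_simps)
  also have "\<dots> = - limsup (\<lambda>T. ereal (S T / real T))"
    by (simp flip: ereal_Liminf_uminus)
  finally show ?thesis
    by (metis ereal_minus_le_minus uminus_ereal.simps(1))
qed


section \<open>Finitely supported expectations\<close>

lemma expectation_bind_pmf_finite:
  fixes h :: "'b \<Rightarrow> real"
  assumes "finite (set_pmf q)" "\<And>x. x \<in> set_pmf q \<Longrightarrow> finite (set_pmf (f x))"
  shows "measure_pmf.expectation (bind_pmf q f) h =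
    measure_pmf.expectation q (\<lambda>x. measure_pmf.expectation (f x) h)"
  using pmf_expectation_bind[OF assms order_refl, where h = h]
  by (simp add: integral_measure_pmf[OF assms(1)])

lemma expectation_mono_finite:
  fixes f g :: "'a \<Rightarrow> real"
  assumes "finite (set_pmf q)" "\<And>x. x \<in> set_pmf q \<Longrightarrow> f x \<le> g x"
  shows "measure_pmf.expectation q f \<le> measure_pmf.expectation q g"
  using assms by (intro integral_mono_AE integrable_measure_pmf_finite) (auto simp: AE_measure_pmf_iff)

lemma expectation_cong_support:
  fixes f g :: "'a \<Rightarrow> real"
  assumes "\<And>x. x \<in> set_pmf q \<Longrightarrow> f x = g x"
  shows "measure_pmf.expectation q f = measure_pmf.expectation q g"
  using assms by (intro integral_cong_AE) (auto simp: AE_measure_pmf_iff)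


section \<open>Dynamics\<close>

text \<open>Invariant of all reachable configurations. The bound on \<open>left\<close> is what
  keeps the potential of busy arms bounded; ages can grow without bound.\<close>

definition valid_status :: "('i, 's) bandits \<Rightarrow> 'i \<Rightarrow> 's status \<Rightarrow> bool" where
  "valid_status B i s \<longleftrightarrow> st s \<in> states B i \<and> 1 \<le> age s \<and>
     (\<not> is_idle s \<longrightarrow> 1 \<le> left s \<and> left s \<le> dur B i (st s))"

definition gain :: "('i, 's) bandits \<Rightarrow> 'i \<Rightarrow> bool \<Rightarrow> 's status \<Rightarrow> real" where
  "gain B i b s = (if b then rew B i (st s) else 0)"

lemma reward_eq_sum_gain: "reward B c A = (\<Sum>i\<in>UNIV. gain B i (i \<in> A) (c i))"
  for A :: "'i::finite set"
  unfolding reward_def gain_def by (simp add: sum.If_cases)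

text \<open>Joint law of history, configuration and action at step \<open>n\<close>, halfway between
  two values of \<open>run\<close>: rewards and drifts depend on the action, which
  \<open>run\<close> records only one step later.\<close>

definition step_pmf :: "('i::finite, 's) bandits \<Rightarrow> ('i, 's) policy \<Rightarrow> ('i, 's) config \<Rightarrow> nat \<Rightarrow>
    (((('i, 's) config \<times> 'i set) list \<times> ('i, 's) config) \<times> 'i set) pmf" where
  "step_pmf B \<pi> c0 n = bind_pmf (run B \<pi> c0 n) (\<lambda>x. map_pmf (Pair x) (\<pi> (fst x) (snd x)))"

lemma set_step_pmf_iff:
  "((hs, c), A) \<in> set_pmf (step_pmf B \<pi> c0 n) \<longleftrightarrow>
     (hs, c) \<in> set_pmf (run B \<pi> c0 n) \<and> A \<in> set_pmf (\<pi> hs c)"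
  by (force simp: step_pmf_def)

lemma run_Suc_step_pmf:
  "run B \<pi> c0 (Suc n) = bind_pmf (step_pmf B \<pi> c0 n)
     (\<lambda>x. map_pmf (Pair ((snd (fst x), snd x) # fst (fst x))) (config_step B (snd (fst x)) (snd x)))"
  by (simp add: step_pmf_def bind_assoc_pmf bind_map_pmf case_prod_unfold)

lemma map_fst_step_pmf: "map_pmf fst (step_pmf B \<pi> c0 n) = run B \<pi> c0 n"
  by (simp add: step_pmf_def map_bind_pmf pmf.map_comp o_def bind_return_pmf')

lemma expected_reward_step_pmf:
  "expected_reward B \<pi> c0 n =
     measure_pmf.expectation (step_pmf B \<pi> c0 n) (\<lambda>x. reward B (snd (fst x)) (snd x))"
proof -
  have "bind_pmf (run B \<pi> c0 n) (\<lambda>(hs, c). map_pmf (reward B c) (\<pi> hs c)) =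
      map_pmf (\<lambda>x. reward B (snd (fst x)) (snd x)) (step_pmf B \<pi> c0 n)"
    by (simp add: step_pmf_def map_bind_pmf pmf.map_comp o_def case_prod_unfold)
  then show ?thesis by (simp add: expected_reward_def)
qed

lemma config_step_component:
  "map_pmf (\<lambda>c'. c' i) (config_step B c A) = arm_step B i (i \<in> A) (c i)"
  by (simp add: config_step_def Pi_pmf_component)

lemma config_step_support:
  assumes "c' \<in> set_pmf (config_step B c A)"
  shows "c' i \<in> set_pmf (arm_step B i (i \<in> A) (c i))"
  using assms config_step_component[of i B c A] by (metis imageI set_map_pmf)

lemma finite_set_config_step:
  assumes "\<And>i. finite (set_pmf (arm_step B i (i \<in> A) (c i)))"
  shows "finite (set_pmf (config_step B c A))"
proof (rule finite_subset)
  show "set_pmf (config_step B c A) \<subseteq> PiE UNIV (\<lambda>i. set_pmf (arm_step B i (i \<in> A) (c i)))"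
    using config_step_support by fastforce
  show "finite (PiE UNIV (\<lambda>i. set_pmf (arm_step B i (i \<in> A) (c i))))"
    using assms by (intro finite_PiE) auto
qed

text \<open>A potential that is a sum over arms sees only the marginals of the product law, so
  drifts can be estimated arm by arm.\<close>

lemma expectation_config_step:
  assumes "\<And>i. finite (set_pmf (arm_step B i (i \<in> A) (c i)))"
  shows "measure_pmf.expectation (config_step B c A) (\<lambda>c'. \<Sum>i\<in>UNIV. \<Phi> i (c' i)) =
    (\<Sum>i\<in>UNIV. measure_pmf.expectation (arm_step B i (i \<in> A) (c i)) (\<Phi> i) :: real)"
proof -
  have "measure_pmf.expectation (config_step B c A) (\<lambda>c'. \<Sum>i\<in>UNIV. \<Phi> i (c' i)) =
      (\<Sum>i\<in>UNIV. measure_pmf.expectation (config_step B c A) (\<lambda>c'. \<Phi> i (c' i)))"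
    by (intro Bochner_Integration.integral_sum integrable_measure_pmf_finite
        finite_set_config_step assms)
  also have "\<dots> = (\<Sum>i\<in>UNIV. measure_pmf.expectation (arm_step B i (i \<in> A) (c i)) (\<Phi> i))"
    by (simp only: config_step_component[symmetric] integral_map_pmf)
  finally show ?thesis .
qed

section \<open>Instance assumptions, invariants and finite supports\<close>

context
  fixes B :: "('i::finite, 's) bandits"
  assumes mb: "monotone_bandits B"
begin

lemma finite_states: "finite (states B i)"
  and states_nonempty: "states B i \<noteq> {}"
  using mb unfolding monotone_bandits_def by blast+

lemma
  assumes "k \<in> states B i"
  shows dur_ge_1: "1 \<le> dur B i k"
    and trans_nonneg: "j \<in> states B i \<Longrightarrow> j \<noteq> k \<Longrightarrow> 0 \<le> trans B i k j"
    and rate_nonneg: "1 \<le> t \<Longrightarrow> 0 \<le> rate B i k t"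
    and rate_le_1: "1 \<le> t \<Longrightarrow> rate B i k t \<le> 1"
    and rate_mono: "1 \<le> t \<Longrightarrow> t \<le> t' \<Longrightarrow> rate B i k t \<le> rate B i k t'"
    and rate_piecewise_linear: "piecewise_linear_on_breaks (brk B i k) (rate B i k)"
proof -
  have *: "1 \<le> dur B i k \<and> 0 \<le> rew B i k \<and>
      (\<forall>j\<in>states B i - {k}. 0 \<le> trans B i k j) \<and>
      (\<Sum>j\<in>states B i - {k}. trans B i k j) \<le> 1 \<and>
      (\<forall>t\<ge>1. 0 \<le> rate B i k t \<and> rate B i k t \<le> 1) \<and>
      mono_on {1..} (rate B i k) \<and> piecewise_linear_on_breaks (brk B i k) (rate B i k)"
    using mb assms unfolding monotone_bandits_def by blast
  show "1 \<le> dur B i k" "piecewise_linear_on_breaks (brk B i k) (rate B i k)"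
    "j \<in> states B i \<Longrightarrow> j \<noteq> k \<Longrightarrow> 0 \<le> trans B i k j"
    "1 \<le> t \<Longrightarrow> 0 \<le> rate B i k t" "1 \<le> t \<Longrightarrow> rate B i k t \<le> 1"
    using * by blast+
  show "1 \<le> t \<Longrightarrow> t \<le> t' \<Longrightarrow> rate B i k t \<le> rate B i k t'"
    using * by (intro mono_onD[of "{1..}" "rate B i k"]) auto
qed

lemma states_connected:
  assumes "j \<in> states B i" "k \<in> states B i"
  shows "(j, k) \<in> {(a, b). a \<in> states B i \<and> b \<in> states B i \<and> trans B i a b > 0}\<^sup>*"
  using mb assms unfolding monotone_bandits_def by blast

lemma set_next_state:
  assumes "k \<in> states B i" "1 \<le> t"
  shows "set_pmf (next_state B i k t) \<subseteq> states B i"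
  using assms by (auto simp: set_pmf_iff pmf_next_state[OF mb] split: if_splits)

text \<open>This is the meaning of \<open>DeltaP\<close>: scaled by the rate, it is the expected
  change of the potential \<open>p\<close> caused by a play.\<close>

lemma expectation_next_state:
  assumes k: "k \<in> states B i" and t: "1 \<le> t"
  shows "measure_pmf.expectation (next_state B i k t) (p i) = p i k + rate B i k t * DeltaP B p i k"
proof -
  let ?N = "states B i - {k}"
  have "measure_pmf.expectation (next_state B i k t) (p i) =
      (\<Sum>j\<in>states B i. p i j * pmf (next_state B i k t) j)"
    using set_next_state[OF assms] by (intro integral_measure_pmf_real finite_states) auto
  also have "\<dots> = p i k * pmf (next_state B i k t) k + (\<Sum>j\<in>?N. p i j * pmf (next_state B i k t) j)"
    by (rule sum.remove[OF finite_states k])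
  also have "(\<Sum>j\<in>?N. p i j * pmf (next_state B i k t) j) =
      (\<Sum>j\<in>?N. p i j * (trans B i k j * rate B i k t))"
    by (intro sum.cong) (auto simp: pmf_next_state[OF mb k t])
  finally show ?thesis
    by (simp add: pmf_next_state[OF mb k t] DeltaP_def algebra_simps sum_distrib_left sum_subtractf)
qed

lemma finite_set_arm_step:
  assumes "valid_status B i s"
  shows "finite (set_pmf (arm_step B i b s))"
proof -
  have "finite (set_pmf (next_state B i (st s) (age s)))"
    using assms by (intro finite_subset[OF set_next_state finite_states]) (auto simp: valid_status_def)
  then show ?thesis
    by (cases s) (simp_all add: arm_step_def progress_def)
qed

lemma valid_status_arm_step:
  assumes "valid_status B i s" "s' \<in> set_pmf (arm_step B i b s)"
  shows "valid_status B i s'"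
proof -
  have "set_pmf (next_state B i (st s) (age s)) \<subseteq> states B i"
    using assms(1) by (intro set_next_state) (simp_all add: valid_status_def)
  moreover have "1 \<le> dur B i (st s)"
    using assms(1) by (intro dur_ge_1) (simp_all add: valid_status_def)
  ultimately show ?thesis
    using assms
    by (cases s) (force simp: arm_step_def progress_def valid_status_def split: if_splits)+
qed

lemma valid_status_start: "start_config B c0 \<Longrightarrow> valid_status B i (c0 i)"
  unfolding start_config_def valid_status_def by (force dest: spec[of _ i])

lemma valid_status_run:
  assumes "start_config B c0" "(hs, c) \<in> set_pmf (run B \<pi> c0 n)"
  shows "valid_status B i (c i)"
  using assms(2)
proof (induction n arbitrary: hs c)
  case 0
  then show ?case using assms(1) by (simp add: valid_status_start)
next
  case (Suc n)
  then obtain hs' c' A where "(hs', c') \<in> set_pmf (run B \<pi> c0 n)" "c \<in> set_pmf (config_step B c' A)"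
    by auto
  then show ?case
    using valid_status_arm_step[of i "c' i" "c i" "i \<in> A"] Suc.IH config_step_support by blast
qed

lemma finite_set_run:
  assumes "start_config B c0"
  shows "finite (set_pmf (run B \<pi> c0 n))"
proof (induction n)
  case (Suc n)
  then show ?case
    using valid_status_run[OF assms]
    by (auto intro!: finite_imageI finite_set_config_step finite_set_arm_step)
qed simp

lemma finite_set_step_pmf:
  assumes "start_config B c0"
  shows "finite (set_pmf (step_pmf B \<pi> c0 n))"
  using finite_set_run[OF assms] by (auto simp: step_pmf_def)

lemma expectation_run_Suc:
  assumes "start_config B c0"
  shows "measure_pmf.expectation (run B \<pi> c0 (Suc n)) (\<lambda>x. \<Sum>i\<in>UNIV. \<Phi> i (snd x i)) =
    measure_pmf.expectation (step_pmf B \<pi> c0 n)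
      (\<lambda>x. \<Sum>i\<in>UNIV. measure_pmf.expectation (arm_step B i (i \<in> snd x) (snd (fst x) i)) (\<Phi> i) :: real)"
proof -
  have fin: "finite (set_pmf (arm_step B i b (snd (fst x) i)))"
    if "x \<in> set_pmf (step_pmf B \<pi> c0 n)" for x i b
    using that valid_status_run[OF assms]
    by (cases x) (auto simp: set_step_pmf_iff intro!: finite_set_arm_step)
  show ?thesis
    unfolding run_Suc_step_pmf
    by (subst expectation_bind_pmf_finite)
       (auto intro!: finite_set_step_pmf[OF assms] finite_set_config_step fin
          expectation_cong_support expectation_config_step)
qed

text \<open>The common potential argument: the drift inequality telescopes, and the final potential
  is absorbed by its upper bound. \<open>R\<close> is left general so that it can be a negated
  reward or the reward of some arms only; \<open>N\<close> allows the first steps to violate the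
  drift condition.\<close>

lemma sum_expectation_ge_of_drift:
  fixes R :: "('i, 's) config \<Rightarrow> 'i set \<Rightarrow> real" and \<Phi> :: "'i \<Rightarrow> 's status \<Rightarrow> real"
  assumes start: "start_config B c0"
    and drift: "\<And>n hs c A. N \<le> n \<Longrightarrow> ((hs, c), A) \<in> set_pmf (step_pmf B \<pi> c0 n) \<Longrightarrow>
      K \<le> R c A +
        (\<Sum>i\<in>UNIV. measure_pmf.expectation (arm_step B i (i \<in> A) (c i)) (\<Phi> i) - \<Phi> i (c i))"
    and bound: "\<And>i s. valid_status B i s \<Longrightarrow> \<Phi> i s \<le> C i"
  obtains D where "\<And>T. N \<le> T \<Longrightarrow> real T * K - D \<le>
    (\<Sum>n<T. measure_pmf.expectation (step_pmf B \<pi> c0 n) (\<lambda>x. R (snd (fst x)) (snd x)))"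
proof -
  define r where "r n = measure_pmf.expectation (step_pmf B \<pi> c0 n) (\<lambda>x. R (snd (fst x)) (snd x))" for n
  define P where "P n = measure_pmf.expectation (run B \<pi> c0 n) (\<lambda>x. \<Sum>i\<in>UNIV. \<Phi> i (snd x i))" for n
  have drift_step: "K \<le> r n + (P (Suc n) - P n)" if "N \<le> n" for n
  proof -
    let ?E = "measure_pmf.expectation (step_pmf B \<pi> c0 n)"
    note int = integrable_measure_pmf_finite[OF finite_set_step_pmf[OF start]]
    have P: "P n = ?E (\<lambda>x. \<Sum>i\<in>UNIV. \<Phi> i (snd (fst x) i))"
      unfolding P_def by (subst map_fst_step_pmf[symmetric]) simp
    have "K = ?E (\<lambda>_. K)" by simp
    also have "\<dots> \<le> ?E (\<lambda>x. R (snd (fst x)) (snd x) +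
        ((\<Sum>i\<in>UNIV. measure_pmf.expectation (arm_step B i (i \<in> snd x) (snd (fst x) i)) (\<Phi> i)) -
         (\<Sum>i\<in>UNIV. \<Phi> i (snd (fst x) i))))"
      using drift[OF that]
      by (intro expectation_mono_finite finite_set_step_pmf start) (auto simp: sum_subtractf)
    also have "\<dots> = r n + (P (Suc n) - P n)"
      unfolding r_def P unfolding P_def expectation_run_Suc[OF start]
      by (subst Bochner_Integration.integral_add Bochner_Integration.integral_diff, (rule int)+)+ simp
    finally show ?thesis .
  qed
  have P_le: "P n \<le> (\<Sum>i\<in>UNIV. C i)" for n
  proof -
    have "P n \<le> measure_pmf.expectation (run B \<pi> c0 n) (\<lambda>_. \<Sum>i\<in>UNIV. C i)"
      unfolding P_def using valid_status_run[OF start] bound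
      by (intro expectation_mono_finite finite_set_run start sum_mono) auto
    then show ?thesis by simp
  qed
  have tele: "(real T - real N) * K \<le> (\<Sum>n<T. r n) - (\<Sum>n<N. r n) + P T - P N" if "N \<le> T" for T
    using that
  proof (induction T rule: dec_induct)
    case (step T)
    then show ?case using drift_step[of T] by (simp add: algebra_simps)
  qed simp
  show thesis
  \<comment> \<open>The constant collects the first \<open>N\<close> steps, the potential at time
    \<open>N\<close> and the upper bound on the potential at time \<open>T\<close>.\<close>
  proof (rule that)
    fix T assume "N \<le> T"
    then show "real T * K - (real N * K + (\<Sum>i\<in>UNIV. C i) - P N - (\<Sum>n<N. r n)) \<le>
      (\<Sum>n<T. measure_pmf.expectation (step_pmf B \<pi> c0 n) (\<lambda>x. R (snd (fst x)) (snd x)))"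
      using tele[of T] P_le[of T] by (simp add: r_def algebra_simps)
  qed
qed

end


section \<open>A single arm that is played whenever it is idle\<close>

primrec solo_law :: "('i, 's) bandits \<Rightarrow> 'i \<Rightarrow> 's status \<Rightarrow> nat \<Rightarrow> 's status pmf" where
  "solo_law B i s 0 = return_pmf s"
| "solo_law B i s (Suc n) = bind_pmf (solo_law B i s n) (arm_step B i True)"

definition solo_reward :: "('i, 's) bandits \<Rightarrow> 'i \<Rightarrow> 's status \<Rightarrow> nat \<Rightarrow> real" where
  "solo_reward B i s n = measure_pmf.expectation (solo_law B i s n) (\<lambda>s. gain B i (is_idle s) s)"

lemma arm_step_busy: "\<not> is_idle s \<Longrightarrow> arm_step B i b s = arm_step B i True s"
  by (cases s) (simp_all add: arm_step_def)

text \<open>The transition of an arm depends only on its own status and on whether it is started, so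
  an arm always started when idle evolves the same way under every policy.\<close>

lemma map_run_eq_solo_law:
  assumes "\<And>n hs c A. ((hs, c), A) \<in> set_pmf (step_pmf B \<pi> c0 n) \<Longrightarrow> is_idle (c i) \<Longrightarrow> i \<in> A"
  shows "map_pmf (\<lambda>x. snd x i) (run B \<pi> c0 n) = solo_law B i (c0 i) n"
proof (induction n)
  case (Suc n)
  have "map_pmf (\<lambda>x. snd x i) (run B \<pi> c0 (Suc n)) =
      bind_pmf (step_pmf B \<pi> c0 n) (\<lambda>x. arm_step B i (i \<in> snd x) (snd (fst x) i))"
    unfolding run_Suc_step_pmf
    by (simp add: map_bind_pmf pmf.map_comp o_def config_step_component)
  also have "\<dots> = bind_pmf (step_pmf B \<pi> c0 n) (\<lambda>x. arm_step B i True (snd (fst x) i))"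
  proof (rule bind_pmf_cong[OF refl])
    fix x assume x: "x \<in> set_pmf (step_pmf B \<pi> c0 n)"
    show "arm_step B i (i \<in> snd x) (snd (fst x) i) = arm_step B i True (snd (fst x) i)"
    proof (cases "is_idle (snd (fst x) i)")
      case True
      then show ?thesis using assms[of "fst (fst x)" "snd (fst x)" "snd x" n] x by simp
    qed (rule arm_step_busy)
  qed
  also have "\<dots> = bind_pmf (map_pmf (\<lambda>x. snd x i) (map_pmf fst (step_pmf B \<pi> c0 n))) (arm_step B i True)"
    by (simp add: bind_map_pmf)
  also have "\<dots> = solo_law B i (c0 i) (Suc n)"
    by (simp only: map_fst_step_pmf Suc.IH solo_law.simps)
  finally show ?case .
qed simp

lemma expectation_gain_eq_solo_reward:
  assumes "\<And>n hs c A. ((hs, c), A) \<in> set_pmf (step_pmf B \<pi> c0 n) \<Longrightarrow> i \<in> A \<longleftrightarrow> is_idle (c i)"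
  shows "measure_pmf.expectation (step_pmf B \<pi> c0 n) (\<lambda>x. gain B i (i \<in> snd x) (snd (fst x) i)) =
    solo_reward B i (c0 i) n"
proof -
  have "measure_pmf.expectation (step_pmf B \<pi> c0 n) (\<lambda>x. gain B i (i \<in> snd x) (snd (fst x) i)) =
      measure_pmf.expectation (step_pmf B \<pi> c0 n)
        (\<lambda>x. gain B i (is_idle (snd (fst x) i)) (snd (fst x) i))"
    using assms by (intro expectation_cong_support) auto
  also have "\<dots> = measure_pmf.expectation (map_pmf (\<lambda>x. snd x i) (map_pmf fst (step_pmf B \<pi> c0 n)))
        (\<lambda>s. gain B i (is_idle s) s)"
    by simp
  also have "\<dots> = solo_reward B i (c0 i) n"
    unfolding map_fst_step_pmf solo_reward_def using assms by (subst map_run_eq_solo_law) auto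
  finally show ?thesis .
qed

lemma set_step_pmf_repeat_play:
  "((hs, c), A) \<in> set_pmf (step_pmf B (repeat_play i) c0 n) \<Longrightarrow> A = (if is_idle (c i) then {i} else {})"
  by (auto simp: set_step_pmf_iff repeat_play_def)

text \<open>Links the reward criterion in \<open>U1\<close> to \<open>solo_reward\<close>, and
  thereby to any policy that plays the arm continuously.\<close>

lemma expected_reward_repeat_play:
  "expected_reward B (repeat_play i) c0 n = solo_reward B i (c0 i) n"
proof -
  have *: "i \<in> A \<longleftrightarrow> is_idle (c i)" if "((hs, c), A) \<in> set_pmf (step_pmf B (repeat_play i) c0 m)" for m hs c A
    using set_step_pmf_repeat_play[OF that] by simp
  have "expected_reward B (repeat_play i) c0 n =
      measure_pmf.expectation (step_pmf B (repeat_play i) c0 n) (\<lambda>x. gain B i (i \<in> snd x) (snd (fst x) i))"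
    unfolding expected_reward_step_pmf
    by (intro expectation_cong_support)
       (auto dest!: set_step_pmf_repeat_play simp: reward_def gain_def split: if_splits)
  also have "\<dots> = solo_reward B i (c0 i) n"
    using * by (rule expectation_gain_eq_solo_reward)
  finally show ?thesis .
qed


section \<open>The linear program at arbitrary elapsed times\<close>

text \<open>Between neighbouring breakpoints both sides are affine in \<open>t\<close>, so the
  inequality at the endpoints suffices; beyond the last breakpoint the left side is constant and the
  right side does not decrease.\<close>

lemma piecewise_linear_le:
  fixes a b c d :: real
  assumes W: "piecewise_linear_on_breaks W f"
    and le: "\<And>w. w \<in> W \<Longrightarrow> c + f w * d \<le> a + real w * b"
    and "0 \<le> b" "1 \<le> t"
  shows "c + f t * d \<le> a + real t * b"
proof -
  have fin: "finite W" and one: "1 \<in> W"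
    and lin: "\<And>u v s. u \<in> W \<Longrightarrow> v \<in> W \<Longrightarrow> u < v \<Longrightarrow> {u<..<v} \<inter> W = {} \<Longrightarrow> s \<in> {u..v} \<Longrightarrow>
      f s = f u + (f v - f u) * (real s - real u) / (real v - real u)"
    and tail: "\<And>s. Max W \<le> s \<Longrightarrow> f s = f (Max W)"
    using W unfolding piecewise_linear_on_breaks_def by blast+
  show ?thesis
  proof (cases "Max W \<le> t")
    case True
    have "c + f (Max W) * d \<le> a + real (Max W) * b"
      using le Max_in[OF fin] one by blast
    also have "\<dots> \<le> a + real t * b"
      using True \<open>0 \<le> b\<close> by (simp add: mult_right_mono)
    finally show ?thesis using tail[OF True] by simp
  next
    case False
    define u where "u = Max {w \<in> W. w \<le> t}"
    define v where "v = Min {w \<in> W. t < w}"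
    have "u \<in> {w \<in> W. w \<le> t}"
      unfolding u_def using fin one \<open>1 \<le> t\<close> by (intro Max_in) auto
    then have u: "u \<in> W" "u \<le> t" by auto
    have "Max W \<in> {w \<in> W. t < w}"
      using Max_in[OF fin] one False by auto
    then have "v \<in> {w \<in> W. t < w}"
      unfolding v_def using fin by (intro Min_in) auto
    then have v: "v \<in> W" "t < v" by auto
    have "\<not> (u < w \<and> w < v)" if "w \<in> W" for w
    proof (cases "w \<le> t")
      case True
      then have "w \<le> u" unfolding u_def using fin that by (intro Max_ge) auto
      then show ?thesis by simp
    next
      case False
      then have "v \<le> w" unfolding v_def using fin that by (intro Min_le) auto
      then show ?thesis by simp
    qed
    then have "{u<..<v} \<inter> W = {}" by auto
    then have ft: "f t = f u + (f v - f u) * (real t - real u) / (real v - real u)"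
      using lin[of u v t] u v by auto
    \<comment> \<open>The weight writing \<open>t\<close> as a convex combination of its
      neighbouring breakpoints \<open>u\<close> and \<open>v\<close>.\<close>
    define s where "s = (real t - real u) / (real v - real u)"
    have s: "0 \<le> s" "s \<le> 1" and "s * (real v - real u) = real t - real u"
      using u v by (auto simp: s_def field_simps)
    then have t: "real t = (1 - s) * real u + s * real v"
      by (simp add: algebra_simps)
    have "c + f t * d = (1 - s) * (c + f u * d) + s * (c + f v * d)"
      unfolding ft times_divide_eq_right[symmetric] s_def[symmetric] by (simp add: algebra_simps)
    also have "\<dots> \<le> (1 - s) * (a + real u * b) + s * (a + real v * b)"
      using s u v by (intro add_mono mult_left_mono le) auto
    also have "\<dots> = a + real t * b"
      unfolding t by (simp add: algebra_simps)
    finally show ?thesis .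
  qed
qed

context
  fixes B :: "('i::finite, 's) bandits"
  assumes mb: "monotone_bandits B"
begin

text \<open>The linear program constrains breakpoints only, whereas a policy may start plays at any
  elapsed time.\<close>

lemma balance_constraint:
  assumes "balance_feasible B M lam h p" "k \<in> states B i" "1 \<le> t"
  shows "balance_rhs B p i k t \<le> balance_lhs B lam h i k t"
proof -
  have "rew B i k + rate B i k t * DeltaP B p i k \<le>
      (real (dur B i k) * (lam + h i) - h i) + real t * h i"
  proof (rule piecewise_linear_le[OF rate_piecewise_linear[OF mb assms(2)] _ _ assms(3)])
    show "0 \<le> h i" using assms(1) by (simp add: balance_feasible_def)
    fix w assume "w \<in> brk B i k"
    then have "balance_lhs B lam h i k w \<ge> balance_rhs B p i k w"
      using assms(1,2) unfolding balance_feasible_def by blast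
    then show "rew B i k + rate B i k w * DeltaP B p i k \<le>
      real (dur B i k) * (lam + h i) - h i + real w * h i"
      by (simp add: balance_lhs_def balance_rhs_def algebra_simps)
  qed
  then show ?thesis by (simp add: balance_lhs_def balance_rhs_def algebra_simps)
qed

end


section \<open>Potentials\<close>

text \<open>
  A play started in \<open>k\<close> is paid off at rate \<open>lam + h i\<close> over its duration; \<open>g i k t\<close> is the
  potential of an arm that is not being played.
\<close>

definition potential :: "('i, 's) bandits \<Rightarrow> real \<Rightarrow> ('i \<Rightarrow> real) \<Rightarrow> ('i \<Rightarrow> 's \<Rightarrow> real) \<Rightarrow>
    ('i \<Rightarrow> 's \<Rightarrow> nat \<Rightarrow> real) \<Rightarrow> 'i \<Rightarrow> 's status \<Rightarrow> real" where
  "potential B lam h p g i s = (case s of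
      Idle k t \<Rightarrow> g i k t
    | Busy k t m \<Rightarrow> p i k + rate B i k t * DeltaP B p i k - real m * (lam + h i))"

context
  fixes B :: "('i::finite, 's) bandits" and lam :: real and h :: "'i \<Rightarrow> real"
    and p :: "'i \<Rightarrow> 's \<Rightarrow> real" and g :: "'i \<Rightarrow> 's \<Rightarrow> nat \<Rightarrow> real" and i :: 'i
  assumes mb: "monotone_bandits B"
    and g_1: "\<And>j. j \<in> states B i \<Longrightarrow> g i j 1 = p i j"
begin

text \<open>One formula covers both outcomes: a busy status already carries the expected potential
  after the play, minus the payments still due, and for \<open>m = 0\<close> nothing is due. The
  assumption \<open>g_1\<close> applies because a finished play leaves age \<open>1\<close>.\<close>

lemma expectation_progress:
  assumes "k \<in> states B i" "1 \<le> t"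
  shows "measure_pmf.expectation (progress B i k t m) (potential B lam h p g i) =
    p i k + rate B i k t * DeltaP B p i k - real m * (lam + h i)"
proof (cases "m = 0")
  case True
  have "measure_pmf.expectation (next_state B i k t) (\<lambda>j. g i j 1) =
      measure_pmf.expectation (next_state B i k t) (p i)"
    using set_next_state[OF mb assms] g_1 by (intro expectation_cong_support) auto
  then show ?thesis
    using True expectation_next_state[OF mb assms] by (simp add: progress_def potential_def)
next
  case False
  then show ?thesis by (simp add: progress_def potential_def)
qed

lemma expectation_potential_start:
  assumes "valid_status B i (Idle k t)"
  shows "measure_pmf.expectation (arm_step B i True (Idle k t)) (potential B lam h p g i) =
    p i k + rate B i k t * DeltaP B p i k - (real (dur B i k) - 1) * (lam + h i)"
  using assms dur_ge_1[OF mb, of k i]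
  by (simp add: arm_step_def valid_status_def expectation_progress of_nat_diff)

lemma expectation_potential_wait:
  "measure_pmf.expectation (arm_step B i False (Idle k t)) (potential B lam h p g i) = g i k (t + 1)"
  by (simp add: arm_step_def potential_def)

lemma expectation_potential_busy:
  assumes "valid_status B i (Busy k t m)"
  shows "measure_pmf.expectation (arm_step B i b (Busy k t m)) (potential B lam h p g i) -
    potential B lam h p g i (Busy k t m) = lam + h i"
  using assms
  by (simp add: arm_step_def valid_status_def expectation_progress potential_def of_nat_diff algebra_simps)

end

text \<open>Two-sided, since the upper bound on the optimum needs the potential bounded below and
  the analysis of BalancedIndex needs it bounded above.\<close>

lemma abs_potential_busy_le:
  fixes B :: "('i::finite, 's) bandits"
  assumes mb: "monotone_bandits B" and "0 \<le> lam" "0 \<le> h i" "valid_status B i (Busy k t m)"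
  shows "\<bar>potential B lam h p g i (Busy k t m)\<bar> \<le>
    \<bar>p i k\<bar> + \<bar>DeltaP B p i k\<bar> + real (dur B i k) * (lam + h i)"
proof -
  have k: "k \<in> states B i" "1 \<le> t" "m \<le> dur B i k" using assms by (auto simp: valid_status_def)
  have "\<bar>rate B i k t * DeltaP B p i k\<bar> \<le> \<bar>DeltaP B p i k\<bar>"
    using rate_nonneg[OF mb k(1,2)] rate_le_1[OF mb k(1,2)]
    by (simp add: abs_mult mult_left_le_one_le)
  moreover have "0 \<le> real m * (lam + h i)" "real m * (lam + h i) \<le> real (dur B i k) * (lam + h i)"
    using assms(2,3) k(3) by (auto intro!: mult_right_mono)
  ultimately show ?thesis unfolding potential_def by (simp add: abs_le_iff) argo
qed


section \<open>Weak duality\<close>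

text \<open>Per step, an arm's reward plus drift is at most \<open>h i\<close>, plus
  \<open>lam\<close> if the arm is occupied; at most \<open>M\<close> arms are occupied at once. For
  the start of a play this is exactly the constraint of the linear program.\<close>

lemma average_reward_le_balance:
  fixes B :: "('i::finite, 's) bandits"
  assumes mb: "monotone_bandits B" and feas: "balance_feasible B M lam h p"
    and adm: "admissible B M \<pi> c0"
  shows "upper_value B \<pi> c0 \<le> ereal (real M * lam + (\<Sum>i\<in>UNIV. h i))"
proof -
  \<comment> \<open>Savings of \<open>h i\<close> per waiting step, without a cap: they match the
    term \<open>(t - 1) * h i\<close> of the constraint.\<close>
  define g where "g i k t = p i k + (real t - 1) * h i" for i :: 'i and k and t :: nat
  define \<Phi> where "\<Phi> = potential B lam h p g"
  have lam0: "0 \<le> lam" and h0: "\<And>i. 0 \<le> h i" using feas by (auto simp: balance_feasible_def)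
  have g_1: "g i k 1 = p i k" for i k by (simp add: g_def)
  note start_eq = expectation_potential_start[OF mb, where g = g and p = p, OF g_1]
    and wait_eq = expectation_potential_wait[OF mb, where g = g and p = p, OF g_1]
    and busy_eq = expectation_potential_busy[OF mb, where g = g and p = p, OF g_1]
  let ?d = "\<lambda>i b s. gain B i b s + (measure_pmf.expectation (arm_step B i b s) (\<Phi> i) - \<Phi> i s)"
  have arm: "?d i b s \<le> h i + (if b \<or> \<not> is_idle s then lam else 0)"
    if valid: "valid_status B i s" and b: "b \<Longrightarrow> is_idle s" for i b s
  proof (cases s)
    case (Idle k t)
    then have k: "k \<in> states B i" "1 \<le> t" using valid by (auto simp: valid_status_def)
    show ?thesis
    proof (cases b)
      case True
      have "balance_rhs B p i k t \<le> balance_lhs B lam h i k t"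
        by (rule balance_constraint[OF mb feas k])
      then show ?thesis
        using True Idle valid by (simp add: start_eq \<Phi>_def gain_def potential_def g_def balance_lhs_def balance_rhs_def algebra_simps)
    next
      case False
      then show ?thesis
        using Idle by (simp add: wait_eq \<Phi>_def gain_def potential_def g_def algebra_simps)
    qed
  next
    case (Busy k t m)
    then show ?thesis using valid b busy_eq by (auto simp: \<Phi>_def gain_def)
  qed
  define C where "C i = (\<Sum>k\<in>states B i. \<bar>p i k\<bar> + \<bar>DeltaP B p i k\<bar> + real (dur B i k) * (lam + h i))" for i
  have C_ge: "\<bar>p i k\<bar> + \<bar>DeltaP B p i k\<bar> + real (dur B i k) * (lam + h i) \<le> C i"
    if "k \<in> states B i" for i k
    unfolding C_def using that lam0 h0 finite_states[OF mb]
    by (intro member_le_sum[of k]) (auto intro!: add_nonneg_nonneg mult_nonneg_nonneg)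
  \<comment> \<open>The drift lemma will be applied to \<open>- \<Phi>\<close>, so only a lower
    bound on \<open>\<Phi>\<close> is required; the unbounded savings are nonnegative and do no
    harm.\<close>
  have bound: "- \<Phi> i s \<le> C i" if "valid_status B i s" for i s
  proof (cases s)
    case (Idle k t)
    then have "k \<in> states B i" "1 \<le> t" using that by (auto simp: valid_status_def)
    moreover have "0 \<le> real (dur B i k) * (lam + h i)" "0 \<le> (real t - 1) * h i"
      using lam0 h0 \<open>1 \<le> t\<close> by auto
    ultimately show ?thesis using C_ge[of k i] Idle by (simp add: \<Phi>_def potential_def g_def)
  next
    case (Busy k t m)
    then have "k \<in> states B i" using that by (auto simp: valid_status_def)
    then show ?thesis
      using C_ge[of k i] abs_potential_busy_le[where h = h and i = i and k = k and t = t and m = m and p = p and g = g, OF mb lam0 h0] that Busy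
      by (simp add: \<Phi>_def)
  qed
  have start: "start_config B c0" using adm by (simp add: admissible_def)
  define K where "K = real M * lam + (\<Sum>i\<in>UNIV. h i)"
  have drift: "- K \<le> - reward B c A +
      (\<Sum>i\<in>UNIV. measure_pmf.expectation (arm_step B i (i \<in> A) (c i)) (\<lambda>s. - \<Phi> i s) - - \<Phi> i (c i))"
    if "((hs, c), A) \<in> set_pmf (step_pmf B \<pi> c0 n)" for n hs c A
  proof -
    have c: "(hs, c) \<in> set_pmf (run B \<pi> c0 n)" and "A \<in> set_pmf (\<pi> hs c)"
      using that by (auto simp: set_step_pmf_iff)
    then have "feasible_action M c A" using adm unfolding admissible_def by fast
    then have A: "A \<subseteq> idle_arms c" "card A + card (busy_arms c) \<le> M"
      by (auto simp: feasible_action_def)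
    have "(\<Sum>i\<in>UNIV. ?d i (i \<in> A) (c i)) \<le> (\<Sum>i\<in>UNIV. h i + (if i \<in> A \<or> \<not> is_idle (c i) then lam else 0))"
      using valid_status_run[OF mb start c] A by (intro sum_mono arm) (auto simp: idle_arms_def)
    also have "\<dots> = (\<Sum>i\<in>UNIV. h i) + lam * real (card (A \<union> busy_arms c))"
      by (simp add: sum.distrib sum.If_cases busy_arms_def Un_def)
    also have "card (A \<union> busy_arms c) = card A + card (busy_arms c)"
      using A by (intro card_Un_disjoint) (auto simp: idle_arms_def busy_arms_def)
    also have "(\<Sum>i\<in>UNIV. h i) + lam * real (card A + card (busy_arms c)) \<le> K"
      using A(2) lam0 unfolding K_def
      by (metis add.commute add_left_mono mult.commute mult_left_mono of_nat_le_iff)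
    finally show ?thesis
      by (simp add: reward_eq_sum_gain sum.distrib sum_subtractf)
  qed
  obtain D where D: "\<And>T. real T * - K - D \<le>
      (\<Sum>n<T. measure_pmf.expectation (step_pmf B \<pi> c0 n) (\<lambda>x. - reward B (snd (fst x)) (snd x)))"
    using sum_expectation_ge_of_drift[OF mb start, where N = 0 and \<pi> = \<pi> and K = "- K" and C = C
        and R = "\<lambda>c A. - reward B c A" and \<Phi> = "\<lambda>i s. - \<Phi> i s"] drift bound by auto
  have "(\<Sum>n<T. expected_reward B \<pi> c0 n) \<le> real T * K + D" for T
    using D[of T] by (simp add: expected_reward_step_pmf sum_negf)
  then show ?thesis
    unfolding upper_value_def average_reward_def K_def[symmetric]
    by (intro limsup_average_le_ereal)
qed

lemma optimal_value_le_balance: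
  fixes B :: "('i::finite, 's) bandits"
  assumes "monotone_bandits B" "balance_feasible B M lam h p"
  shows "optimal_value B M \<le> ereal (real M * lam + (\<Sum>i\<in>UNIV. h i))"
  unfolding optimal_value_def
  using average_reward_le_balance[OF assms] by (intro SUP_least) auto


section \<open>Tightness at an optimal solution\<close>

lemma rtrancl_leaves_set:
  assumes "(x, y) \<in> r\<^sup>*" "x \<in> T" "y \<notin> T"
  obtains a b where "(a, b) \<in> r" "a \<in> T" "b \<notin> T"
  using assms by (induction rule: rtrancl_induct) blast+

lemma DeltaP_decrease_other:
  assumes "b \<in> states B i" "k \<noteq> b" "finite (states B i)"
  shows "DeltaP B (p(i := (p i)(b := p i b - e))) i k = DeltaP B p i k - trans B i k b * e"
proof -
  have "DeltaP B (p(i := (p i)(b := p i b - e))) i k =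
      (\<Sum>j\<in>states B i - {k}. trans B i k j * (p i j - p i k) - (if j = b then trans B i k b * e else 0))"
    using assms(2) unfolding DeltaP_def by (intro sum.cong) (auto simp: algebra_simps)
  also have "\<dots> = DeltaP B p i k - trans B i k b * e"
    using assms by (simp add: sum_subtractf DeltaP_def)
  finally show ?thesis .
qed

lemma DeltaP_decrease_self:
  "DeltaP B (p(i := (p i)(b := p i b - e))) i b =
    DeltaP B p i b + e * (\<Sum>j\<in>states B i - {b}. trans B i b j)"
proof -
  have "DeltaP B (p(i := (p i)(b := p i b - e))) i b =
      (\<Sum>j\<in>states B i - {b}. trans B i b j * (p i j - p i b) + e * trans B i b j)"
    unfolding DeltaP_def by (intro sum.cong) (auto simp: algebra_simps)
  then show ?thesis by (simp add: sum.distrib DeltaP_def sum_distrib_left)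
qed

context
  fixes B :: "('i::finite, 's) bandits"
  assumes mb: "monotone_bandits B"
begin

lemma
  assumes "k \<in> states B i"
  shows finite_brk: "finite (brk B i k)"
    and one_in_brk: "1 \<in> brk B i k"
    and brk_ge_1: "t \<in> brk B i k \<Longrightarrow> 1 \<le> t"
proof -
  have *: "finite (brk B i k)" "1 \<in> brk B i k" "0 \<notin> brk B i k"
    using rate_piecewise_linear[OF mb assms] unfolding piecewise_linear_on_breaks_def by blast+
  then show "finite (brk B i k)" "1 \<in> brk B i k" by blast+
  show "1 \<le> t" if "t \<in> brk B i k"
    using *(3) that by (cases t) auto
qed

lemma trans_sum_le_1: "k \<in> states B i \<Longrightarrow> (\<Sum>j\<in>states B i - {k}. trans B i k j) \<le> 1"
  using mb unfolding monotone_bandits_def by blast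

text \<open>
  Lowering the value of a state without tight constraints that has a tight predecessor makes the
  predecessor slack and no state tight; by strong connectivity such a state exists until all
  constraints of the arm are slack.
\<close>

lemma slacken_arm:
  assumes "\<And>k t. k \<in> states B i \<Longrightarrow> t \<in> brk B i k \<Longrightarrow> balance_rhs B p i k t \<le> balance_lhs B lam h i k t"
    and rew_lt: "\<And>k t. k \<in> states B i \<Longrightarrow> t \<in> brk B i k \<Longrightarrow> rate B i k t = 0 \<Longrightarrow>
      rew B i k < balance_lhs B lam h i k t"
    and k0: "k0 \<in> states B i"
    and "\<And>t. t \<in> brk B i k0 \<Longrightarrow> balance_rhs B p i k0 t < balance_lhs B lam h i k0 t"
  shows "\<exists>p'. (\<forall>j. j \<noteq> i \<longrightarrow> p' j = p j) \<and>
    (\<forall>k\<in>states B i. \<forall>t\<in>brk B i k. balance_rhs B p' i k t < balance_lhs B lam h i k t)"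
  using assms(1,4)
proof (induction "card {k \<in> states B i. \<exists>t\<in>brk B i k. balance_rhs B p i k t = balance_lhs B lam h i k t}"
    arbitrary: p rule: less_induct)
  case less
  let ?tight = "\<lambda>p. {k \<in> states B i. \<exists>t\<in>brk B i k. balance_rhs B p i k t = balance_lhs B lam h i k t}"
  let ?L = "balance_lhs B lam h i"
  note le = less.prems(1) and k0_lt = less.prems(2)
  note fin = finite_states[OF mb, of i]
  show ?case
  proof (cases "?tight p = {}")
    case True
    have "balance_rhs B p i k t < ?L k t" if "k \<in> states B i" "t \<in> brk B i k" for k t
      using le[OF that] True that by force
    then show ?thesis by (intro exI[of _ p]) blast
  next
    case False
    then obtain x where x: "x \<in> states B i" "x \<in> ?tight p" by blast
    have "k0 \<notin> ?tight p" using k0_lt by force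
    \<comment> \<open>A path from the tight state \<open>x\<close> to the slack state
      \<open>k0\<close> has an edge leaving the set of tight states.\<close>
    obtain a b where "(a, b) \<in> {(a, b). a \<in> states B i \<and> b \<in> states B i \<and> 0 < trans B i a b}"
        and "a \<in> ?tight p" and "b \<notin> ?tight p"
      by (rule rtrancl_leaves_set[OF states_connected[OF mb x(1) k0] x(2) \<open>k0 \<notin> ?tight p\<close>])
    then have ab: "a \<in> states B i" "b \<in> states B i" "0 < trans B i a b"
        "a \<in> ?tight p" "b \<notin> ?tight p"
      by simp_all
    then have "a \<noteq> b" by metis
    have slack: "0 < ?L b t - balance_rhs B p i b t" if "t \<in> brk B i b" for t
      using le[OF ab(2) that] ab(2,5) that by force
    \<comment> \<open>Half of the least slack at \<open>b\<close>: lowering \<open>p i b\<close> by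
      \<open>e\<close> raises the right-hand sides at \<open>b\<close> by at most \<open>e\<close>,
      as the rate and the total transition weight are at most \<open>1\<close>.\<close>
    define e where "e = Min ((\<lambda>t. ?L b t - balance_rhs B p i b t) ` brk B i b) / 2"
    have "0 < Min ((\<lambda>t. ?L b t - balance_rhs B p i b t) ` brk B i b)"
      using slack finite_brk[OF ab(2)] one_in_brk[OF ab(2)] by (subst Min_gr_iff) auto
    then have e: "0 < e" by (simp add: e_def)
    have e_lt: "balance_rhs B p i b t + e < ?L b t" if "t \<in> brk B i b" for t
    proof -
      have "2 * e \<le> ?L b t - balance_rhs B p i b t"
        unfolding e_def using that finite_brk[OF ab(2)] by auto
      then show ?thesis using e by simp
    qed
    define p' where "p' = p(i := (p i)(b := p i b - e))"
    have other: "balance_rhs B p' i k t = balance_rhs B p i k t - rate B i k t * (trans B i k b * e)"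
      if "k \<noteq> b" for k t
      unfolding balance_rhs_def p'_def DeltaP_decrease_other[OF ab(2) that fin]
      by (simp add: algebra_simps)
    have other_le: "balance_rhs B p' i k t \<le> balance_rhs B p i k t"
      if "k \<in> states B i" "k \<noteq> b" "t \<in> brk B i k" for k t
    proof -
      have "0 \<le> rate B i k t * (trans B i k b * e)"
        using that e brk_ge_1[OF that(1,3)] ab(2)
        by (intro mult_nonneg_nonneg rate_nonneg[OF mb] trans_nonneg[OF mb]) auto
      then show ?thesis using other[OF that(2)] by simp
    qed
    have self: "balance_rhs B p' i b t < ?L b t" if t: "t \<in> brk B i b" for t
    proof -
      have t1: "1 \<le> t" using brk_ge_1[OF ab(2) t] .
      have "rate B i b t * (e * (\<Sum>j\<in>states B i - {b}. trans B i b j)) \<le> 1 * (e * 1)"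
        using t1 e ab(2)
        by (intro mult_mono rate_le_1[OF mb] trans_sum_le_1 mult_left_mono mult_nonneg_nonneg
            sum_nonneg trans_nonneg[OF mb]) auto
      then show ?thesis
        using e_lt[OF t] by (simp add: balance_rhs_def p'_def DeltaP_decrease_self algebra_simps)
    qed
    have a_slack: "balance_rhs B p' i a t < ?L a t" if t: "t \<in> brk B i a" for t
    \<comment> \<open>At rate \<open>0\<close> the constraint does not react to changes of
      \<open>p\<close>, so its slackness has to come from \<open>rew_lt\<close>.\<close>
    proof (cases "rate B i a t = 0")
      case True
      then show ?thesis using rew_lt[OF ab(1) t] by (simp add: balance_rhs_def)
    next
      case False
      then have "0 < rate B i a t * (trans B i a b * e)"
        using rate_nonneg[OF mb ab(1) brk_ge_1[OF ab(1) t]] ab(3) e by simp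
      then show ?thesis using le[OF ab(1) t] other[OF \<open>a \<noteq> b\<close>, of t] by simp
    qed
    have le': "balance_rhs B p' i k t \<le> ?L k t" if "k \<in> states B i" "t \<in> brk B i k" for k t
      using that self[of t] other_le[of k t] le[of k t] by (cases "k = b") auto
    have "?tight p' \<subseteq> ?tight p - {a}"
    proof
      fix k assume "k \<in> ?tight p'"
      then obtain t where k: "k \<in> states B i" "t \<in> brk B i k" "balance_rhs B p' i k t = ?L k t" by blast
      then have "k \<noteq> a" "k \<noteq> b" using a_slack self by force+
      moreover have "balance_rhs B p i k t = ?L k t"
        using other_le[OF k(1) \<open>k \<noteq> b\<close> k(2)] le[OF k(1,2)] k(3) by simp
      ultimately show "k \<in> ?tight p - {a}" using k by blast
    qed
    then have "?tight p' \<subset> ?tight p" using ab(4) by blast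
    then have "card (?tight p') < card (?tight p)"
      using fin by (intro psubset_card_mono) auto
    moreover have "balance_rhs B p' i k0 t < ?L k0 t" if "t \<in> brk B i k0" for t
      using that self[of t] other_le[OF k0, of t] k0_lt[of t] by (cases "k0 = b") auto
    ultimately obtain p'' where "\<forall>j. j \<noteq> i \<longrightarrow> p'' j = p' j"
        "\<forall>k\<in>states B i. \<forall>t\<in>brk B i k. balance_rhs B p'' i k t < ?L k t"
      using less.hyps[of p'] le' by blast
    then show ?thesis by (intro exI[of _ p'']) (auto simp: p'_def)
  qed
qed

text \<open>By monotonicity the rate also vanishes at elapsed time \<open>1\<close>, so back-to-back
  plays never leave \<open>k\<close>. Each play then earns at least \<open>lam + h i\<close> per
  step of its duration.\<close>

lemma in_U1_if_absorbing:
  assumes k: "k \<in> states B i" and t: "1 \<le> t" and f0: "rate B i k t = 0"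
    and h: "0 < h i" and le: "balance_lhs B lam h i k t \<le> rew B i k"
  shows "i \<in> U1 B lam h"
proof -
  define c0 where "c0 j = (if j = i then Idle k 1 else Idle (SOME k. k \<in> states B j) 1)" for j
  have start: "start_config B c0"
    unfolding start_config_def c0_def using k states_nonempty[OF mb] by (auto simp: some_in_eq)
  have "rate B i k 1 = 0"
    using f0 rate_mono[OF mb k, of 1 t] rate_nonneg[OF mb k, of 1] t by simp
  then have stay: "next_state B i k 1 = return_pmf k"
    by (intro pmf_eqI) (auto simp: pmf_next_state[OF mb k] indicator_def)
  have "0 \<le> (real t - 1) * h i" using t h by simp
  then have rew: "real (dur B i k) * (lam + h i) \<le> rew B i k"
    using le unfolding balance_lhs_def by linarith
  have solo: "s \<in> set_pmf (solo_law B i (Idle k 1) n) \<Longrightarrow> st s = k \<and> age s = 1" for s n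
  proof (induction n arbitrary: s)
    case (Suc n)
    then obtain s' where "s' \<in> set_pmf (solo_law B i (Idle k 1) n)" "s \<in> set_pmf (arm_step B i True s')"
      by auto
    with Suc.IH[of s'] stay show ?case
      by (cases s') (auto simp: arm_step_def progress_def split: if_splits)
  qed simp
  \<comment> \<open>With zero values for the states, the potential only spreads the reward of a play
    evenly over its duration.\<close>
  define \<Phi> where "\<Phi> j = (if j = i then potential B lam h (\<lambda>_ _. 0) (\<lambda>_ _ _. 0) i else (\<lambda>_. 0))" for j
  note start_eq = expectation_potential_start[OF mb, where g = "\<lambda>_ _ _. 0" and p = "\<lambda>_ _. 0", OF refl]
    and busy_eq = expectation_potential_busy[OF mb, where g = "\<lambda>_ _ _. 0" and p = "\<lambda>_ _. 0", OF refl]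
  have D0: "DeltaP B (\<lambda>_ _. 0) i k = 0" for k by (simp add: DeltaP_def)
  have drift: "lam + h i \<le> reward B c A +
      (\<Sum>j\<in>UNIV. measure_pmf.expectation (arm_step B j (j \<in> A) (c j)) (\<Phi> j) - \<Phi> j (c j))"
    if x: "((hs, c), A) \<in> set_pmf (step_pmf B (repeat_play i) c0 n)" for n hs c A
  proof -
    have A: "A = (if is_idle (c i) then {i} else {})" by (rule set_step_pmf_repeat_play[OF x])
    have c: "(hs, c) \<in> set_pmf (run B (repeat_play i) c0 n)" using x by (simp add: set_step_pmf_iff)
    have valid: "valid_status B i (c i)" by (rule valid_status_run[OF mb start c])
    have law: "map_pmf (\<lambda>x. snd x i) (run B (repeat_play i) c0 n) = solo_law B i (c0 i) n"
      by (rule map_run_eq_solo_law) (auto dest!: set_step_pmf_repeat_play)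
    have "c i \<in> set_pmf (map_pmf (\<lambda>x. snd x i) (run B (repeat_play i) c0 n))"
      using c by force
    then have "c i \<in> set_pmf (solo_law B i (Idle k 1) n)"
      unfolding law by (simp add: c0_def)
    then have "st (c i) = k" using solo by blast
    have "(\<Sum>j\<in>UNIV. measure_pmf.expectation (arm_step B j (j \<in> A) (c j)) (\<Phi> j) - \<Phi> j (c j)) =
        (\<Sum>j\<in>UNIV. if j = i then measure_pmf.expectation (arm_step B i (i \<in> A) (c i)) (\<Phi> i) - \<Phi> i (c i) else 0)"
      by (intro sum.cong) (auto simp: \<Phi>_def)
    also have "\<dots> = measure_pmf.expectation (arm_step B i (i \<in> A) (c i)) (\<Phi> i) - \<Phi> i (c i)"
      by simp
    finally have *: "(\<Sum>j\<in>UNIV. measure_pmf.expectation (arm_step B j (j \<in> A) (c j)) (\<Phi> j) - \<Phi> j (c j)) = \<dots>" .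
    show ?thesis
    proof (cases "c i")
      case (Idle k' t')
      then show ?thesis
        using A \<open>st (c i) = k\<close> rew valid unfolding *
        by (simp add: start_eq D0 \<Phi>_def reward_def potential_def algebra_simps)
    next
      case (Busy k' t' m)
      then show ?thesis
        using A valid busy_eq[of i k' t' m] unfolding * by (simp add: \<Phi>_def reward_def)
    qed
  qed
  \<comment> \<open>The absolute value is taken because the sign of \<open>lam\<close> is not fixed
    here.\<close>
  define C where "C j = (if j = i then \<Sum>k\<in>states B i. real (dur B i k) * \<bar>lam + h i\<bar> else 0)" for j
  have bound: "\<Phi> j s \<le> C j"
    if "valid_status B j s" for j s
  proof (cases "j = i")
    case True
    show ?thesis
    proof (cases s)
      case (Idle k' t')
      then show ?thesis using True by (auto simp: \<Phi>_def C_def potential_def intro!: sum_nonneg)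
    next
      case (Busy k' t' m)
      then have k': "k' \<in> states B i" "m \<le> dur B i k'" using that True by (auto simp: valid_status_def)
      have "- (real m * (lam + h i)) \<le> real m * \<bar>lam + h i\<bar>"
        by (metis abs_ge_minus_self abs_mult abs_of_nat)
      also have "\<dots> \<le> real (dur B i k') * \<bar>lam + h i\<bar>" using k' by (intro mult_right_mono) auto
      also have "\<dots> \<le> (\<Sum>k\<in>states B i. real (dur B i k) * \<bar>lam + h i\<bar>)"
        using k' finite_states[OF mb] by (intro member_le_sum) auto
      finally show ?thesis using True Busy by (simp add: \<Phi>_def C_def potential_def D0)
    qed
  qed (simp add: \<Phi>_def C_def)
  obtain D where "\<And>T. real T * (lam + h i) - D \<le> (\<Sum>n<T. expected_reward B (repeat_play i) c0 n)"
    using sum_expectation_ge_of_drift[OF mb start, where N = 0 and \<pi> = "repeat_play i"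
        and K = "lam + h i" and R = "reward B" and \<Phi> = \<Phi> and C = C] drift bound
    by (auto simp: expected_reward_step_pmf)
  then have "ereal (lam + h i) \<le> lower_value B (repeat_play i) c0"
    unfolding lower_value_def average_reward_def by (intro ereal_le_liminf_average)
  then show ?thesis using start h unfolding U1_def by blast
qed

text \<open>
  If all constraints of an arm were slack, its \<open>h i\<close> could be decreased; decreasing \<open>lam\<close> and
  increasing all other \<open>h j\<close> by the same amount keeps the solution balanced and feasible.
\<close>

lemma tight_if_not_in_U1:
  assumes "1 \<le> M" and opt: "balance_optimal B M lam h p"
    and hi: "0 < h i" and nU1: "i \<notin> U1 B lam h" and k0: "k0 \<in> states B i"
  shows "\<exists>t\<in>brk B i k0. balance_lhs B lam h i k0 t = balance_rhs B p i k0 t"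
proof (rule ccontr)
  assume not_tight: "\<not> ?thesis"
  have feas: "balance_feasible B M lam h p"
    and min: "\<And>lam' h' p'. balance_feasible B M lam' h' p' \<Longrightarrow>
        real M * lam + (\<Sum>i\<in>UNIV. h i) \<le> real M * lam' + (\<Sum>i\<in>UNIV. h' i)"
    using opt unfolding balance_optimal_def by blast+
  have h0: "\<And>j. 0 \<le> h j" and bal: "real M * lam = (\<Sum>i\<in>UNIV. h i)"
    and cons: "\<And>j k t. k \<in> states B j \<Longrightarrow> t \<in> brk B j k \<Longrightarrow> balance_rhs B p j k t \<le> balance_lhs B lam h j k t"
    using feas unfolding balance_feasible_def by blast+
  have "h i \<le> (\<Sum>i\<in>UNIV. h i)" using h0 by (intro member_le_sum) auto
  then have "0 < real M * lam" using hi bal by simp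
  then have lam: "0 < lam" by (simp add: zero_less_mult_iff)
  have "\<exists>p'. (\<forall>j. j \<noteq> i \<longrightarrow> p' j = p j) \<and>
      (\<forall>k\<in>states B i. \<forall>t\<in>brk B i k. balance_rhs B p' i k t < balance_lhs B lam h i k t)"
  proof (rule slacken_arm[OF cons _ k0])
    show "rew B i k < balance_lhs B lam h i k t"
      if "k \<in> states B i" "t \<in> brk B i k" "rate B i k t = 0" for k t
      using in_U1_if_absorbing[of k i t h lam] that brk_ge_1[OF that(1,2)] hi nU1 by force
    show "balance_rhs B p i k0 t < balance_lhs B lam h i k0 t" if "t \<in> brk B i k0" for t
      using cons[OF k0 that] not_tight that by force
  qed
  then obtain p' where p': "\<And>j. j \<noteq> i \<Longrightarrow> p' j = p j"
      "\<And>k t. k \<in> states B i \<Longrightarrow> t \<in> brk B i k \<Longrightarrow> balance_rhs B p' i k t < balance_lhs B lam h i k t"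
    by blast
  define X where "X = (SIGMA k:states B i. brk B i k)"
  \<comment> \<open>Lowering \<open>h i\<close> by \<open>e\<close> and \<open>lam\<close> by some
    \<open>d \<le> e\<close> lowers the left-hand side by at most \<open>e * (2 * dur + t)\<close>,
    so \<open>e \<le> sl (k, t)\<close> preserves the constraint.\<close>
  define sl where "sl = (\<lambda>(k, t). (balance_lhs B lam h i k t - balance_rhs B p' i k t) / (2 * real (dur B i k) + real t))"
  define e where "e = Min (insert (h i) (insert lam (sl ` X)))"
  have "finite X" unfolding X_def using finite_states[OF mb] finite_brk by auto
  have sl_pos: "0 < sl x" if "x \<in> X" for x
    using that p'(2) brk_ge_1 unfolding X_def sl_def
    by (auto intro!: divide_pos_pos add_nonneg_pos simp: Suc_le_eq)
  have "e \<in> insert (h i) (insert lam (sl ` X))"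
    unfolding e_def using \<open>finite X\<close> by (intro Min_in) auto
  then have "0 < e" using sl_pos lam hi by blast
  moreover have e_le: "e \<le> x" if "x \<in> insert (h i) (insert lam (sl ` X))" for x
    unfolding e_def using \<open>finite X\<close> that by (intro Min_le) auto
  ultimately have e: "0 < e" "e \<le> h i" "e \<le> lam" and e_sl: "\<And>x. x \<in> X \<Longrightarrow> e \<le> sl x"
    by blast+
  \<comment> \<open>Balance forces this value: \<open>M * d = e - (CARD('i) - 1) * d\<close> when
    the other arms each gain \<open>d\<close>.\<close>
  define N where "N = real M + (real CARD('i) - 1)"
  define d where "d = e / N"
  have "1 \<le> CARD('i)" by (simp add: Suc_leI)
  then have N: "1 \<le> N" using \<open>1 \<le> M\<close> unfolding N_def by linarith
  then have d: "0 < d" "d \<le> e" "N * d = e" using e by (auto simp: d_def field_simps)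
  define h' where "h' j = (if j = i then h i - e else h j + d)" for j
  have "(\<Sum>j\<in>UNIV. h' j) = (\<Sum>j\<in>UNIV. h j + d - (if j = i then e + d else 0))"
    by (intro sum.cong) (auto simp: h'_def)
  also have "\<dots> = (\<Sum>j\<in>UNIV. h j) + real CARD('i) * d - (e + d)"
    by (simp add: sum_subtractf sum.distrib)
  also have "\<dots> = real M * (lam - d)"
    using d(3) bal unfolding N_def by (simp add: algebra_simps)
  finally have bal': "real M * (lam - d) = (\<Sum>j\<in>UNIV. h' j)" ..
  have "balance_feasible B M (lam - d) h' p'"
    unfolding balance_feasible_def
  proof (intro conjI allI ballI)
    show "0 \<le> lam - d" using d e by simp
    show "0 \<le> h' j" for j using h0[of j] d e by (simp add: h'_def)
    show "real M * (lam - d) = (\<Sum>j\<in>UNIV. h' j)" by (rule bal')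
    fix j k t assume k: "k \<in> states B j" and t: "t \<in> brk B j k"
    have t1: "1 \<le> t" by (rule brk_ge_1[OF k t])
    show "balance_rhs B p' j k t \<le> balance_lhs B (lam - d) h' j k t"
    proof (cases "j = i")
      case True
      have pos: "0 < 2 * real (dur B i k) + real t" using t1 by simp
      have "e \<le> sl (k, t)" using True k t by (intro e_sl) (auto simp: X_def)
      then have "e * (2 * real (dur B i k) + real t) \<le> balance_lhs B lam h i k t - balance_rhs B p' i k t"
        using pos by (simp add: sl_def pos_le_divide_eq)
      moreover have "real (dur B i k) * d \<le> real (dur B i k) * e"
        using d by (intro mult_left_mono) auto
      ultimately show ?thesis
        using True e by (simp add: balance_lhs_def h'_def algebra_simps)
    next
      case False
      have "balance_rhs B p' j k t = balance_rhs B p j k t"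
        using p'(1)[OF False] by (simp add: balance_rhs_def DeltaP_def)
      also have "\<dots> \<le> balance_lhs B lam h j k t" by (rule cons[OF k t])
      also have "\<dots> \<le> balance_lhs B (lam - d) h' j k t"
      \<comment> \<open>For the other arms \<open>lam + h j\<close> is unchanged, and only the
        waiting term grows.\<close>
      proof -
        have "0 \<le> (real t - 1) * d" using t1 d by simp
        then show ?thesis using False by (simp add: balance_lhs_def h'_def algebra_simps)
      qed
      finally show ?thesis .
    qed
  qed
  from min[OF this] have "real M * lam \<le> real M * (lam - d)"
    using bal bal' by simp
  then show False using d \<open>1 \<le> M\<close> by simp
qed

end


section \<open>The BalancedIndex policy\<close>

lemma length_run: "(hs, c) \<in> set_pmf (run B \<pi> c0 n) \<Longrightarrow> length hs = n"
  by (induction n arbitrary: hs c) auto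

text \<open>Ensures that players of BalancedIndex are occupied only by arms of \<open>V\<close> and
  \<open>U2\<close>, which matters when occupied players are counted.\<close>

lemma busy_arms_run_subset:
  assumes start: "start_config B c0"
    and A: "\<And>n hs c A. ((hs, c), A) \<in> set_pmf (step_pmf B \<pi> c0 n) \<Longrightarrow> A \<subseteq> S"
    and "(hs, c) \<in> set_pmf (run B \<pi> c0 n)"
  shows "busy_arms c \<subseteq> S"
  using assms(3)
proof (induction n arbitrary: hs c)
  case 0
  have "is_idle (c0 i)" for i
    using start unfolding start_config_def by (metis status.disc(1))
  then show ?case using 0 by (simp add: busy_arms_def)
next
  case (Suc n)
  from Suc.prems obtain hs' c' A where c': "(hs', c') \<in> set_pmf (run B \<pi> c0 n)"
      and "A \<in> set_pmf (\<pi> hs' c')" and c: "c \<in> set_pmf (config_step B c' A)"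
    by auto
  then have "A \<subseteq> S" using A[of hs' c' A n] by (simp add: set_step_pmf_iff)
  show ?case
  proof
    fix i assume "i \<in> busy_arms c"
    then have "\<not> is_idle (c i)" by (simp add: busy_arms_def)
    moreover have "c i \<in> set_pmf (arm_step B i (i \<in> A) (c' i))" by (rule config_step_support[OF c])
    ultimately have "i \<in> A \<or> i \<in> busy_arms c'"
      by (cases "c' i") (auto simp: arm_step_def busy_arms_def split: if_splits)
    then show "i \<in> S" using \<open>A \<subseteq> S\<close> Suc.IH[OF c'] by blast
  qed
qed

lemma lower_value_repeat_play:
  "lower_value B (repeat_play i) c0 = liminf (\<lambda>T. ereal ((\<Sum>n<T. solo_reward B i (c0 i) n) / real T))"
  by (simp add: lower_value_def average_reward_def expected_reward_repeat_play)

section \<open>Payments earned by BalancedIndex at an optimal solution\<close>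

context
  fixes B :: "('i::finite, 's) bandits" and M :: nat and lam :: real and h :: "'i \<Rightarrow> real"
    and p :: "'i \<Rightarrow> 's \<Rightarrow> real"
  assumes mb: "monotone_bandits B" and M: "1 \<le> M" and opt: "balance_optimal B M lam h p"
begin

lemma balance_nonneg: "0 \<le> lam" "0 \<le> h i"
  and balance_eq: "real M * lam = (\<Sum>i\<in>UNIV. h i)"
  using opt unfolding balance_optimal_def balance_feasible_def by blast+

lemma U2_tight:
  assumes "i \<in> U2 B lam h" "k \<in> states B i"
  shows "\<exists>t\<in>brk B i k. balance_lhs B lam h i k t = balance_rhs B p i k t"
proof (rule tight_if_not_in_U1[OF mb M opt _ _ assms(2)])
  show "0 < h i" "i \<notin> U1 B lam h" using assms(1) by (simp_all add: U2_def)
qed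

lemma
  assumes "i \<in> U2 B lam h" "k \<in> states B i"
  shows ready_time_tight: "balance_lhs B lam h i k (ready_time B lam h p i k) =
      balance_rhs B p i k (ready_time B lam h p i k)"
    and ready_time_ge_1: "1 \<le> ready_time B lam h p i k"
proof -
  have *: "ready_time B lam h p i k \<in> brk B i k \<and>
      balance_lhs B lam h i k (ready_time B lam h p i k) =
      balance_rhs B p i k (ready_time B lam h p i k)"
    unfolding ready_time_def by (rule LeastI_ex) (use U2_tight[OF assms] in blast)
  then show "balance_lhs B lam h i k (ready_time B lam h p i k) =
      balance_rhs B p i k (ready_time B lam h p i k)" by blast
  show "1 \<le> ready_time B lam h p i k" by (rule brk_ge_1[OF mb assms(2) conjunct1[OF *]])
qed

text \<open>For negative \<open>DeltaP\<close> the right-hand side does not increase with elapsed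
  time and the left-hand side does not decrease, so tightness at any time forces tightness at
  \<open>1\<close>.\<close>

lemma G_states_tight_at_1:
  assumes i: "i \<in> U2 B lam h" and k: "k \<in> G_states B p i"
  shows "real (dur B i k) * (lam + h i) = rew B i k + rate B i k 1 * DeltaP B p i k"
proof -
  have ks: "k \<in> states B i" and neg: "DeltaP B p i k < 0" using k by (auto simp: G_states_def)
  obtain t where t: "t \<in> brk B i k" "balance_lhs B lam h i k t = balance_rhs B p i k t"
    using U2_tight[OF i ks] by blast
  have t1: "1 \<le> t" using brk_ge_1[OF mb ks t(1)] .
  have "balance_rhs B p i k 1 \<le> balance_lhs B lam h i k 1"
    using opt by (intro balance_constraint[OF mb _ ks]) (auto simp: balance_optimal_def)
  moreover have "rate B i k t * DeltaP B p i k \<le> rate B i k 1 * DeltaP B p i k"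
    using rate_mono[OF mb ks order_refl t1] neg by (intro mult_right_mono_neg) auto
  moreover have "0 \<le> (real t - 1) * h i"
    using t1 balance_nonneg(2)[of i] by simp
  ultimately show ?thesis
    using t(2) unfolding balance_lhs_def balance_rhs_def by simp
qed

text \<open>For nonnegative \<open>DeltaP\<close>, playing later than the ready time can only
  improve the expected outcome, while only the savings up to the ready time must be covered.\<close>

lemma ready_play_pays:
  assumes i: "i \<in> U2 B lam h" and k: "k \<in> I_states B p i" and le: "ready_time B lam h p i k \<le> t"
  shows "real (dur B i k) * (lam + h i) + (real (ready_time B lam h p i k) - 1) * h i \<le>
    rew B i k + rate B i k t * DeltaP B p i k"
proof -
  have ks: "k \<in> states B i" and "0 \<le> DeltaP B p i k" using k by (auto simp: I_states_def G_states_def)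
  then have "rate B i k (ready_time B lam h p i k) * DeltaP B p i k \<le> rate B i k t * DeltaP B p i k"
    using rate_mono[OF mb ks ready_time_ge_1[OF i ks] le] by (intro mult_right_mono)
  then show ?thesis
    using ready_time_tight[OF i ks] unfolding balance_lhs_def balance_rhs_def by simp
qed

text \<open>
  An arm in a state of \<open>I_states\<close> accumulates \<open>h i\<close> per step until it is ready. In a state of
  \<open>G_states\<close>, elapsed times other than \<open>1\<close> arise only from the start, and \<open>DeltaP\<close> covers the
  loss of playing the arm once at such a time.
\<close>

definition waiting_potential :: "'i \<Rightarrow> 's \<Rightarrow> nat \<Rightarrow> real" where
  "waiting_potential i k t =
     (if k \<in> G_states B p i then if t = 1 then p i k else p i k + DeltaP B p i k
      else p i k + (real (min t (ready_time B lam h p i k)) - 1) * h i)"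

definition index_potential :: "'i \<Rightarrow> 's status \<Rightarrow> real" where
  "index_potential = potential B lam h p waiting_potential"

text \<open>The zero case concerns arms left waiting although they could be played; this happens
  only when all players are occupied, and then the shares \<open>lam\<close> suffice.\<close>

definition payment :: "'i \<Rightarrow> bool \<Rightarrow> 's status \<Rightarrow> real" where
  "payment i b s =
     (if b \<or> \<not> is_idle s then lam + h i
      else if st s \<in> G_states B p i \<or> ready_time B lam h p i (st s) \<le> age s then 0 else h i)"

text \<open>The assumption \<open>cont\<close> excludes the one harmful wait: an unplayed arm in
  \<open>G_states\<close> of age \<open>1\<close> would drop in potential by
  \<open>- DeltaP\<close>.\<close>

lemma payment_le_drift:
  assumes i: "i \<in> U2 B lam h" and valid: "valid_status B i s"
    and b: "b \<Longrightarrow> is_idle s \<and> (st s \<in> G_states B p i \<or> ready_time B lam h p i (st s) \<le> age s)"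
    and cont: "is_idle s \<Longrightarrow> st s \<in> G_states B p i \<Longrightarrow> age s = 1 \<Longrightarrow> b"
  shows "payment i b s \<le> gain B i b s +
    (measure_pmf.expectation (arm_step B i b s) (index_potential i) - index_potential i s)"
proof -
  have g_1: "waiting_potential i j 1 = p i j" if "j \<in> states B i" for j
    using ready_time_ge_1[OF i that] by (simp add: waiting_potential_def min_def)
  note start_eq = expectation_potential_start[OF mb, where g = waiting_potential and p = p, OF g_1]
    and wait_eq = expectation_potential_wait[OF mb, where g = waiting_potential and p = p, OF g_1]
    and busy_eq = expectation_potential_busy[OF mb, where g = waiting_potential and p = p, OF g_1]
  show ?thesis
  proof (cases s)
    case (Busy k t m)
    then have "\<not> b" using b by auto
    then show ?thesis
      using Busy valid busy_eq[of k t m] by (simp add: payment_def gain_def index_potential_def)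
  next
    case (Idle k t)
    then have k: "k \<in> states B i" "1 \<le> t" using valid by (auto simp: valid_status_def)
    show ?thesis
    proof (cases b)
      case True
      have *: "real (dur B i k) * (lam + h i) \<le>
          rew B i k + p i k + rate B i k t * DeltaP B p i k - waiting_potential i k t"
      proof (cases "k \<in> G_states B p i")
        case G: True
        then have "DeltaP B p i k < 0" by (simp add: G_states_def)
        show ?thesis
        proof (cases "t = 1")
          case True
          then show ?thesis using G_states_tight_at_1[OF i G] G by (simp add: waiting_potential_def)
        next
          case False
          \<comment> \<open>As \<open>rate - 1 \<le> 0 \<le> rate\<close> and \<open>DeltaP\<close>
            is negative, the reduced initial potential covers a first play at an age other than
            \<open>1\<close>.\<close>
          have "rate B i k 1 * DeltaP B p i k \<le> (rate B i k t - 1) * DeltaP B p i k"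
            using rate_le_1[OF mb k] rate_nonneg[OF mb k(1), of 1] \<open>DeltaP B p i k < 0\<close>
            by (intro mult_right_mono_neg) auto
          then show ?thesis
            using False G_states_tight_at_1[OF i G] G by (simp add: waiting_potential_def algebra_simps)
        qed
      next
        case notG: False
        then have "k \<in> I_states B p i" "ready_time B lam h p i k \<le> t"
          using k b True Idle by (auto simp: I_states_def)
        from ready_play_pays[OF i this] show ?thesis
          using notG \<open>ready_time B lam h p i k \<le> t\<close> by (simp add: waiting_potential_def min_absorb2)
      qed
      then show ?thesis
        using True Idle valid
        by (simp add: payment_def gain_def index_potential_def start_eq potential_def algebra_simps)
    next
      case False
      have "payment i b s \<le> waiting_potential i k (t + 1) - waiting_potential i k t"
        using False Idle k cont balance_nonneg(2)[of i]
        by (auto simp: payment_def waiting_potential_def min_def algebra_simps)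
      then show ?thesis
        using False Idle wait_eq[of k t] by (simp add: gain_def index_potential_def potential_def)
    qed
  qed
qed

text \<open>The cap at the ready time bounds the savings however long an arm waits.\<close>

lemma index_potential_le:
  assumes i: "i \<in> U2 B lam h" and valid: "valid_status B i s"
  shows "index_potential i s \<le> (\<Sum>k\<in>states B i. \<bar>p i k\<bar> + \<bar>DeltaP B p i k\<bar> +
    real (dur B i k) * (lam + h i) + real (ready_time B lam h p i k) * h i)"
proof -
  let ?c = "\<lambda>k. \<bar>p i k\<bar> + \<bar>DeltaP B p i k\<bar> +
    real (dur B i k) * (lam + h i) + real (ready_time B lam h p i k) * h i"
  have nonneg: "0 \<le> real (dur B i k) * (lam + h i)" "0 \<le> real (ready_time B lam h p i k) * h i" for k
    using balance_nonneg(1) balance_nonneg(2)[of i] by auto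
  have "index_potential i s \<le> ?c (st s)"
  proof (cases s)
    case (Idle k t)
    have "(real (min t (ready_time B lam h p i k)) - 1) * h i \<le> real (ready_time B lam h p i k) * h i"
      using balance_nonneg(2)[of i] by (intro mult_right_mono) auto
    then show ?thesis
      using Idle nonneg[of k] by (auto simp: index_potential_def potential_def waiting_potential_def)
  next
    case (Busy k t m)
    then show ?thesis
      using abs_potential_busy_le[where h = h and i = i and k = k and t = t and m = m and p = p
          and g = waiting_potential, OF mb balance_nonneg(1) balance_nonneg(2)] valid nonneg(2)[of k]
      by (simp add: index_potential_def)
  qed
  also have "\<dots> \<le> (\<Sum>k\<in>states B i. ?c k)"
    using valid nonneg finite_states[OF mb]
    by (intro member_le_sum[of "st s" _ ?c]) (auto simp: valid_status_def intro!: add_nonneg_nonneg)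
  finally show ?thesis .
qed

text \<open>If a player idles, every arm of \<open>U2\<close> is either occupied or still saving, so
  it pays at least \<open>h i\<close>. Otherwise \<open>M - card V\<close> players serve
  \<open>U2\<close> and pay at least \<open>lam\<close> each. Which case occurs may vary with the
  step, hence the minimum.\<close>

lemma payments_ge:
  assumes act: "balanced_index_action B M lam h p V hs c A"
    and V: "V \<subseteq> U1 B lam h" and busy: "busy_arms c \<subseteq> V \<union> U2 B lam h"
    and valid: "\<And>i. valid_status B i (c i)"
  shows "min (real (M - card V) * lam) (\<Sum>i\<in>U2 B lam h. h i) \<le>
    (\<Sum>i\<in>U2 B lam h. payment i (i \<in> A) (c i))"
proof -
  let ?U = "U2 B lam h"
  have feas: "A \<subseteq> idle_arms c" "card A + card (busy_arms c) \<le> M"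
    and VA: "V \<inter> idle_arms c \<subseteq> A"
    and A: "A \<subseteq> V \<union> G_avail B lam h p c \<union> I_ready B lam h p c"
    and full: "card A + card (busy_arms c) < M \<Longrightarrow> G_avail B lam h p c \<union> I_ready B lam h p c \<subseteq> A"
    using act unfolding balanced_index_action_def feasible_action_def by blast+
  show ?thesis
  proof (cases "card A + card (busy_arms c) < M")
    case True
    have "h i \<le> payment i (i \<in> A) (c i)" if "i \<in> ?U" for i
      using full[OF True] that valid[of i] balance_nonneg(1)
      by (auto simp: payment_def G_avail_def I_ready_def I_states_def valid_status_def)
    then have "(\<Sum>i\<in>?U. h i) \<le> (\<Sum>i\<in>?U. payment i (i \<in> A) (c i))" by (rule sum_mono)
    then show ?thesis by simp
  next
    case False
    have "V \<inter> ?U = {}" using V by (auto simp: U2_def)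
    have "V \<subseteq> A \<union> busy_arms c" using VA by (auto simp: idle_arms_def busy_arms_def)
    moreover have "A \<subseteq> V \<union> ?U" using A by (auto simp: G_avail_def I_ready_def)
    ultimately have eq: "?U \<inter> (A \<union> busy_arms c) = (A \<union> busy_arms c) - V"
      using busy \<open>V \<inter> ?U = {}\<close> by blast
    have "card (A \<union> busy_arms c) = card A + card (busy_arms c)"
      using feas(1) by (intro card_Un_disjoint) (auto simp: idle_arms_def busy_arms_def)
    then have "card (?U \<inter> (A \<union> busy_arms c)) = M - card V"
      unfolding eq using False feas(2) \<open>V \<subseteq> A \<union> busy_arms c\<close> by (subst card_Diff_subset) auto
    then have "real (M - card V) * lam = (\<Sum>i\<in>?U. if i \<in> A \<union> busy_arms c then lam else 0)"
      by (simp add: sum.If_cases Int_def)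
    also have "\<dots> \<le> (\<Sum>i\<in>?U. payment i (i \<in> A) (c i))"
      using balance_nonneg by (intro sum_mono) (auto simp: payment_def busy_arms_def)
    finally show ?thesis by simp
  qed
qed

text \<open>Both entries of the minimum must suffice. The first completes \<open>card V\<close>
  shares of \<open>lam\<close> to \<open>M\<close>. For the second, either \<open>V\<close> alone
  has \<open>M\<close> shares, or \<open>V = U1\<close> and the sum of all \<open>h i\<close> is
  \<open>M * lam\<close> by balance.\<close>

lemma balance_le_split:
  assumes V: "V \<subseteq> U1 B lam h" "card V = min M (card (U1 B lam h))"
  shows "real M * lam \<le> (\<Sum>i\<in>V. lam + h i) + min (real (M - card V) * lam) (\<Sum>i\<in>U2 B lam h. h i)"
proof -
  let ?U = "U2 B lam h"
  have VU: "V \<inter> ?U = {}" using V by (auto simp: U2_def)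
  have "card V \<le> M" using V(2) by simp
  then have "real M * lam \<le> (\<Sum>i\<in>V. lam + h i) + real (M - card V) * lam"
    using balance_nonneg by (simp add: sum.distrib sum_nonneg of_nat_diff algebra_simps)
  moreover have "real M * lam \<le> (\<Sum>i\<in>V. lam + h i) + (\<Sum>i\<in>?U. h i)"
  proof (cases "M \<le> card (U1 B lam h)")
    case True
    then have "real M * lam = (\<Sum>i\<in>V. lam)" using V(2) by simp
    also have "\<dots> \<le> (\<Sum>i\<in>V. lam + h i)" using balance_nonneg by (intro sum_mono) simp
    finally show ?thesis using balance_nonneg by (simp add: sum_nonneg add_increasing2)
  next
    case False
    then have "V = U1 B lam h" using V by (intro card_subset_eq) auto
    \<comment> \<open>Arms outside \<open>U1\<close> and \<open>U2\<close> have
      \<open>h i = 0\<close>.\<close>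
    then have "(\<Sum>i\<in>UNIV. h i) = (\<Sum>i\<in>V \<union> ?U. h i)"
      using balance_nonneg(2) by (intro sum.mono_neutral_right) (auto simp: U2_def order.order_iff_strict)
    also have "\<dots> = (\<Sum>i\<in>V. h i) + (\<Sum>i\<in>?U. h i)"
      using VU by (intro sum.union_disjoint) auto
    finally show ?thesis
      using balance_nonneg(1) by (simp add: balance_eq sum.distrib)
  qed
  ultimately show ?thesis by (simp add: min_def)
qed

section \<open>Reward of one execution, split between \<open>V\<close> and \<open>U2\<close>\<close>

context
  fixes \<pi> :: "('i, 's) policy" and c0 :: "('i, 's) config" and V :: "'i set"
  assumes start: "start_config B c0" and V: "V \<subseteq> U1 B lam h"
    and act: "\<And>n hs c A. ((hs, c), A) \<in> set_pmf (step_pmf B \<pi> c0 n) \<Longrightarrow>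
      balanced_index_action B M lam h p V hs c A"
begin

lemma V_disjoint_U2: "V \<inter> U2 B lam h = {}"
  using V by (auto simp: U2_def)

lemma index_action_subset:
  "((hs, c), A) \<in> set_pmf (step_pmf B \<pi> c0 n) \<Longrightarrow> A \<subseteq> V \<union> U2 B lam h"
  using act[of hs c A n] by (auto simp: balanced_index_action_def G_avail_def I_ready_def)

text \<open>The drift argument starts at step \<open>1\<close>, because at step \<open>0\<close> an
  arm in \<open>G_states\<close> with age \<open>1\<close> need not be played.\<close>

lemma U2_gains_ge:
  obtains D where "\<And>T. 1 \<le> T \<Longrightarrow>
    real T * min (real (M - card V) * lam) (\<Sum>i\<in>U2 B lam h. h i) - D \<le>
    (\<Sum>n<T. measure_pmf.expectation (step_pmf B \<pi> c0 n)
      (\<lambda>x. \<Sum>i\<in>U2 B lam h. gain B i (i \<in> snd x) (snd (fst x) i)))"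
proof -
  let ?U = "U2 B lam h"
  define K where "K = min (real (M - card V) * lam) (\<Sum>i\<in>?U. h i)"
  define R where "R c A = (\<Sum>i\<in>?U. gain B i (i \<in> A) (c i))" for c :: "('i, 's) config" and A
  define \<Phi> where "\<Phi> i = (if i \<in> ?U then index_potential i else (\<lambda>_. 0))" for i
  define C where "C i = (if i \<in> ?U then \<Sum>k\<in>states B i. \<bar>p i k\<bar> + \<bar>DeltaP B p i k\<bar> +
    real (dur B i k) * (lam + h i) + real (ready_time B lam h p i k) * h i else 0)" for i
  have drift: "K \<le> R c A +
      (\<Sum>i\<in>UNIV. measure_pmf.expectation (arm_step B i (i \<in> A) (c i)) (\<Phi> i) - \<Phi> i (c i))"
    if n: "1 \<le> n" and x: "((hs, c), A) \<in> set_pmf (step_pmf B \<pi> c0 n)" for n hs c A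
  proof -
    have c: "(hs, c) \<in> set_pmf (run B \<pi> c0 n)" using x by (simp add: set_step_pmf_iff)
    note valid = valid_status_run[OF mb start c]
    have "hs \<noteq> []" using length_run[OF c] n by auto
    note a = act[OF x, unfolded balanced_index_action_def feasible_action_def]
    have "K \<le> (\<Sum>i\<in>?U. payment i (i \<in> A) (c i))"
      unfolding K_def using busy_arms_run_subset[OF start index_action_subset c] valid
      by (intro payments_ge[OF act[OF x] V]) auto
    also have "\<dots> \<le> (\<Sum>i\<in>?U. gain B i (i \<in> A) (c i) +
        (measure_pmf.expectation (arm_step B i (i \<in> A) (c i)) (index_potential i) - index_potential i (c i)))"
    proof (intro sum_mono payment_le_drift valid)
      fix i assume i: "i \<in> ?U"
      then have "i \<notin> V" using V_disjoint_U2 by blast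
      then show "i \<in> A \<Longrightarrow> is_idle (c i) \<and>
          (st (c i) \<in> G_states B p i \<or> ready_time B lam h p i (st (c i)) \<le> age (c i))"
        using a by (auto simp: G_avail_def I_ready_def)
      show "is_idle (c i) \<Longrightarrow> st (c i) \<in> G_states B p i \<Longrightarrow> age (c i) = 1 \<Longrightarrow> i \<in> A"
        using a i \<open>hs \<noteq> []\<close> by (auto simp: G_avail_def)
    qed
    also have "\<dots> = R c A + (\<Sum>i\<in>?U.
        measure_pmf.expectation (arm_step B i (i \<in> A) (c i)) (\<Phi> i) - \<Phi> i (c i))"
      by (simp add: R_def sum.distrib \<Phi>_def)
    also have "(\<Sum>i\<in>?U. measure_pmf.expectation (arm_step B i (i \<in> A) (c i)) (\<Phi> i) - \<Phi> i (c i)) =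
        (\<Sum>i\<in>UNIV. measure_pmf.expectation (arm_step B i (i \<in> A) (c i)) (\<Phi> i) - \<Phi> i (c i))"
      by (intro sum.mono_neutral_left) (auto simp: \<Phi>_def)
    finally show ?thesis .
  qed
  have bound: "\<Phi> i s \<le> C i" if "valid_status B i s" for i s
    using index_potential_le[OF _ that] by (simp add: \<Phi>_def C_def)
  let ?E = "\<lambda>n. measure_pmf.expectation (step_pmf B \<pi> c0 n)"
  obtain D where D: "\<And>T. 1 \<le> T \<Longrightarrow> real T * K - D \<le> (\<Sum>n<T. ?E n (\<lambda>x. R (snd (fst x)) (snd x)))"
    using sum_expectation_ge_of_drift[OF mb start, where N = 1 and \<pi> = \<pi> and K = K and R = R
        and \<Phi> = \<Phi> and C = C] drift bound by auto
  then show thesis unfolding K_def R_def by (rule that)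
qed

text \<open>Arms of \<open>V\<close> are started exactly when idle, so they earn what repeated play
  from the same start earns.\<close>

lemma expected_reward_split:
  "expected_reward B \<pi> c0 n = (\<Sum>i\<in>V. solo_reward B i (c0 i) n) +
    measure_pmf.expectation (step_pmf B \<pi> c0 n)
      (\<lambda>x. \<Sum>i\<in>U2 B lam h. gain B i (i \<in> snd x) (snd (fst x) i))"
proof -
  let ?U = "U2 B lam h" and ?E = "measure_pmf.expectation (step_pmf B \<pi> c0 n)"
  have solo: "?E (\<lambda>x. gain B i (i \<in> snd x) (snd (fst x) i)) = solo_reward B i (c0 i) n" if "i \<in> V" for i
  proof (rule expectation_gain_eq_solo_reward)
    show "i \<in> A \<longleftrightarrow> is_idle (c i)" if "((hs, c), A) \<in> set_pmf (step_pmf B \<pi> c0 m)" for m hs c A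
      using act[OF that] \<open>i \<in> V\<close>
      by (auto simp: balanced_index_action_def feasible_action_def idle_arms_def)
  qed
  note int = integrable_measure_pmf_finite[OF finite_set_step_pmf[OF mb start]]
  have reward: "reward B (snd (fst x)) (snd x) = (\<Sum>i\<in>V. gain B i (i \<in> snd x) (snd (fst x) i)) +
      (\<Sum>i\<in>?U. gain B i (i \<in> snd x) (snd (fst x) i))"
    if "x \<in> set_pmf (step_pmf B \<pi> c0 n)" for x
  proof -
    have "snd x \<subseteq> V \<union> ?U"
      using index_action_subset[of "fst (fst x)" "snd (fst x)" "snd x" n] that by simp
    then have "reward B (snd (fst x)) (snd x) = (\<Sum>i\<in>V \<union> ?U. gain B i (i \<in> snd x) (snd (fst x) i))"
      unfolding reward_eq_sum_gain by (intro sum.mono_neutral_right) (auto simp: gain_def)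
    then show ?thesis
      using V_disjoint_U2 by (simp add: sum.union_disjoint)
  qed
  have "expected_reward B \<pi> c0 n = ?E (\<lambda>x. (\<Sum>i\<in>V. gain B i (i \<in> snd x) (snd (fst x) i)) +
      (\<Sum>i\<in>?U. gain B i (i \<in> snd x) (snd (fst x) i)))"
    unfolding expected_reward_step_pmf using reward by (rule expectation_cong_support)
  also have "\<dots> = ?E (\<lambda>x. \<Sum>i\<in>V. gain B i (i \<in> snd x) (snd (fst x) i)) +
      ?E (\<lambda>x. \<Sum>i\<in>?U. gain B i (i \<in> snd x) (snd (fst x) i))"
    by (rule Bochner_Integration.integral_add[OF int int])
  also have "?E (\<lambda>x. \<Sum>i\<in>V. gain B i (i \<in> snd x) (snd (fst x) i)) =
      (\<Sum>i\<in>V. ?E (\<lambda>x. gain B i (i \<in> snd x) (snd (fst x) i)))"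
    by (rule Bochner_Integration.integral_sum[OF int])
  finally show ?thesis by (simp add: solo)
qed

end

text \<open>The arms of \<open>V\<close> are controlled only through their liminf, those of
  \<open>U2\<close> by an explicit linear bound; superadditivity of the liminf combines
  both.\<close>

lemma balanced_index_lower_value:
  assumes bi: "balanced_index B M lam h p \<pi> c0"
  shows "ereal (real M * lam) \<le> lower_value B \<pi> c0"
proof -
  obtain V where start: "start_config B c0" and V: "V \<subseteq> U1 B lam h" "card V = min M (card (U1 B lam h))"
    and V_val: "\<And>i. i \<in> V \<Longrightarrow> ereal (lam + h i) \<le> lower_value B (repeat_play i) c0"
    and "\<forall>n. \<forall>(hs, c)\<in>set_pmf (run B \<pi> c0 n). \<forall>A\<in>set_pmf (\<pi> hs c). balanced_index_action B M lam h p V hs c A"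
    using bi unfolding balanced_index_def by blast
  then have act: "balanced_index_action B M lam h p V hs c A"
    if "((hs, c), A) \<in> set_pmf (step_pmf B \<pi> c0 n)" for n hs c A
    using that unfolding set_step_pmf_iff by fast
  let ?R = "\<lambda>n. measure_pmf.expectation (step_pmf B \<pi> c0 n)
    (\<lambda>x. \<Sum>i\<in>U2 B lam h. gain B i (i \<in> snd x) (snd (fst x) i))"
  define K where "K = min (real (M - card V) * lam) (\<Sum>i\<in>U2 B lam h. h i)"
  obtain D where "\<And>T. 1 \<le> T \<Longrightarrow> real T * K - D \<le> (\<Sum>n<T. ?R n)"
    unfolding K_def by (rule U2_gains_ge[OF start V(1)]; (erule act | blast))
  then have "ereal K \<le> liminf (\<lambda>T. ereal ((\<Sum>n<T. ?R n) / real T))"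
    by (rule ereal_le_liminf_average)
  moreover have "ereal (\<Sum>i\<in>V. lam + h i) \<le>
      liminf (\<lambda>T. ereal (\<Sum>i\<in>V. (\<Sum>n<T. solo_reward B i (c0 i) n) / real T))"
    using V_val unfolding lower_value_repeat_play by (intro ereal_le_liminf_sum) auto
  moreover have "expected_reward B \<pi> c0 n = (\<Sum>i\<in>V. solo_reward B i (c0 i) n) + ?R n" for n
    by (rule expected_reward_split[OF start V(1)]) (rule act)
  then have "average_reward B \<pi> c0 T =
      (\<Sum>i\<in>V. (\<Sum>n<T. solo_reward B i (c0 i) n) / real T) + (\<Sum>n<T. ?R n) / real T" for T
    unfolding average_reward_def
    by (simp add: sum.distrib add_divide_distrib sum_divide_distrib sum.swap[of _ V])
  ultimately have "ereal ((\<Sum>i\<in>V. lam + h i) + K) \<le> lower_value B \<pi> c0"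
    unfolding lower_value_def by (simp add: ereal_le_liminf_add)
  moreover have "ereal (real M * lam) \<le> ereal ((\<Sum>i\<in>V. lam + h i) + K)"
    unfolding K_def using balance_le_split[OF V] by simp
  ultimately show ?thesis by (rule order_trans[rotated])
qed

end

theorem theorem8:
  fixes B :: "('i::finite, 's) bandits" and M :: nat
    and lam :: real and h :: "'i \<Rightarrow> real" and p :: "'i \<Rightarrow> 's \<Rightarrow> real"
    and \<pi> :: "('i, 's) policy" and c0 :: "('i, 's) config"
  assumes "monotone_bandits B"
    and "M \<ge> 1"
    and "balance_optimal B M lam h p"
    and "balanced_index B M lam h p \<pi> c0"
  shows "lower_value B \<pi> c0 \<ge> optimal_value B M / 2"
proof -
  have "balance_feasible B M lam h p" using assms(3) by (simp add: balance_optimal_def)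
  then have "optimal_value B M \<le> ereal (real M * lam + (\<Sum>i\<in>UNIV. h i))"
    by (rule optimal_value_le_balance[OF assms(1)])
  also have "\<dots> = ereal (2 * (real M * lam))"
    using balance_eq[OF assms(1-3)] by simp
  finally have "optimal_value B M / 2 \<le> ereal (2 * (real M * lam)) / 2"
    by (intro ereal_divide_right_mono) auto
  also have "\<dots> = ereal (real M * lam)" by simp
  also have "\<dots> \<le> lower_value B \<pi> c0"
    by (rule balanced_index_lower_value[OF assms])
  finally show ?thesis .
qed

end
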